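(* Let $(P,\le,\delta)\in\mathbb{P}$. If $(P,\le,\delta)$ is unbounded but not minimally unbounded, then $T_P$ is Borel complete.
   Context: $\mathbb{P}$ is the class of triples $(P,\le,\delta)$ where $(P,\le)$ is a countable poset such that $\{q\in P:q\le p\}$ is finite for every $p\in P$, and $\delta:P\to\omega\setminus\{0,1\}$ is an arbitrary function. A subset $Q\subseteq P$ (in particular $P$ itself) is bounded if there is $m<\omega$ such that $\delta(q)\le m$ for all $q\in Q$ and every chain in $Q$ has at most $m$ elements; otherwise it is unbounded. $(P,\le,\delta)$ is minimally unbounded if $P$ is unbounded, and for every downward closed $Q\subseteq P$, either $Q$ or $P\setminus Q$ is bounded. $T_P=T(P,\le,\delta)$ is the first-order theory in the language $\mathcal{L}_P=\{E_q:q\in P\}$ of binary relation symbols with axioms: (a) each $E_q$ is an equivalence relation; (b) if $q'\le q$ then $E_q$ refines $E_{q'}$, and, letting $E_{<q}(x,y):=\bigwedge_{q'<q}E_{q'}(x,y)$, $E_q$ partitions each $E_{<q}$-class into precisely $\delta(q)$ classes; (c) for every finite downward closed $Q\subseteq P$ and every sequence $(a_q:q\in Q)$ satisfying $E_{q'}(a_{q'},a_q)$ for all $q'\le q$ in $Q$, there is $a^*$ with $E_q(a^*,a_q)$ for all $q\in Q$. For a sentence $\Phi$ of $\mathcal{L}_{\omega_1,\omega}$ (or a first-order theory) in a countable language, $\mathrm{Mod}(\Phi)$ is the standard Borel space of models of $\Phi$ with universe $\omega$. A Borel reduction from $\Phi$ to $\Psi$ is a Borel $f:\mathrm{Mod}(\Phi)\to\mathrm{Mod}(\Psi)$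 with $M\cong N\iff f(M)\cong f(N)$. $\Psi$ is Borel complete if every such $\Phi$ (in any countable language) Borel reduces to $\Psi$. *)

theory Defs
  imports "HOL-Analysis.Analysis"
begin

section \<open>Infinitary logic and structures with universe omega\<close>

record 's lang =
  rels :: "'s set"
  rel_ar :: "'s \<Rightarrow> nat"
  funs :: "'s set"
  fun_ar :: "'s \<Rightarrow> nat"

datatype 's trm = Var nat | App 's "'s trm list"

text \<open>
  \<open>Conj\<close> takes a sequence of formulas. This covers conjunctions of all countable sets: a finite
  nonempty one by repetition, and the empty one as \<open>Tru\<close> below. Disjunctions are obtained by
  duality. The formulas without \<open>Conj\<close> are the finitary first-order ones.
\<close>
datatype 's fm =
    Eq "'s trm" "'s trm"
  | Rel 's "'s trm list"
  | Neg "'s fm"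
  | And "'s fm" "'s fm"
  | Conj "nat \<Rightarrow> 's fm"
  | All nat "'s fm"

primrec wf_trm :: "'s lang \<Rightarrow> 's trm \<Rightarrow> bool" where
  "wf_trm L (Var n) \<longleftrightarrow> True"
| "wf_trm L (App f ts) \<longleftrightarrow>
     f \<in> funs L \<and> length ts = fun_ar L f \<and> (\<forall>b \<in> set (map (wf_trm L) ts). b)"

primrec wf_fm :: "'s lang \<Rightarrow> 's fm \<Rightarrow> bool" where
  "wf_fm L (Eq s t) \<longleftrightarrow> wf_trm L s \<and> wf_trm L t"
| "wf_fm L (Rel r ts) \<longleftrightarrow> r \<in> rels L \<and> length ts = rel_ar L r \<and> (\<forall>t \<in> set ts. wf_trm L t)"
| "wf_fm L (Neg \<phi>) \<longleftrightarrow> wf_fm L \<phi>"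
| "wf_fm L (And \<phi> \<psi>) \<longleftrightarrow> wf_fm L \<phi> \<and> wf_fm L \<psi>"
| "wf_fm L (Conj \<Phi>) \<longleftrightarrow> (\<forall>n. wf_fm L (\<Phi> n))"
| "wf_fm L (All v \<phi>) \<longleftrightarrow> wf_fm L \<phi>"

primrec fv_trm :: "'s trm \<Rightarrow> nat set" where
  "fv_trm (Var n) = {n}"
| "fv_trm (App f ts) = \<Union> (set (map fv_trm ts))"

primrec fv :: "'s fm \<Rightarrow> nat set" where
  "fv (Eq s t) = fv_trm s \<union> fv_trm t"
| "fv (Rel r ts) = (\<Union>t \<in> set ts. fv_trm t)"
| "fv (Neg \<phi>) = fv \<phi>"
| "fv (And \<phi> \<psi>) = fv \<phi> \<union> fv \<psi>"
| "fv (Conj \<Phi>) = (\<Union>n. fv (\<Phi> n))"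
| "fv (All v \<phi>) = fv \<phi> - {v}"

primrec first_order :: "'s fm \<Rightarrow> bool" where
  "first_order (Eq s t) \<longleftrightarrow> True"
| "first_order (Rel r ts) \<longleftrightarrow> True"
| "first_order (Neg \<phi>) \<longleftrightarrow> first_order \<phi>"
| "first_order (And \<phi> \<psi>) \<longleftrightarrow> first_order \<phi> \<and> first_order \<psi>"
| "first_order (Conj \<Phi>) \<longleftrightarrow> False"
| "first_order (All v \<phi>) \<longleftrightarrow> first_order \<phi>"

text \<open>
  The free variables of a subformula of a sentence are among the finitely many variables quantified
  above it, so the usual restriction of infinitary formulas to finitely many free variables holds
  automatically inside sentences.
\<close>
definition sentences :: "'s lang \<Rightarrow> 's fm set" where
  "sentences L = {\<phi>. wf_fm L \<phi> \<and> fv \<phi> = {}}"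

type_synonym 's struc = "('s \<Rightarrow> nat list \<Rightarrow> bool) \<times> ('s \<Rightarrow> nat list \<Rightarrow> nat)"

text \<open>
  An \<open>L\<close>-structure on omega interprets the symbols of \<open>L\<close> on tuples of the right length. The other
  values carry no information and are fixed, so that \<open>Str L\<close>, with the subspace topology of the
  product topology on \<open>'s struc\<close> (\<open>bool\<close> and \<open>nat\<close> being discrete), is the usual space of
  \<open>L\<close>-structures with universe omega: the product of one copy of \<open>bool\<close> for each relation symbol
  and each tuple of its arity, and one copy of \<open>nat\<close> for each function symbol and each such tuple.
\<close>
definition Str :: "'s lang \<Rightarrow> 's struc set" where
  "Str L = {(R, F).
     (\<forall>s xs. R s xs \<longrightarrow> s \<in> rels L \<and> length xs = rel_ar L s) \<and>
     (\<forall>s xs. \<not> (s \<in> funs L \<and> length xs = fun_ar L s) \<longrightarrow> F s xs = 0)}"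

primrec val :: "'s struc \<Rightarrow> (nat \<Rightarrow> nat) \<Rightarrow> 's trm \<Rightarrow> nat" where
  "val M e (Var n) = e n"
| "val M e (App f ts) = snd M f (map (val M e) ts)"

primrec sat :: "'s struc \<Rightarrow> (nat \<Rightarrow> nat) \<Rightarrow> 's fm \<Rightarrow> bool" where
  "sat M e (Eq s t) \<longleftrightarrow> val M e s = val M e t"
| "sat M e (Rel r ts) \<longleftrightarrow> fst M r (map (val M e) ts)"
| "sat M e (Neg \<phi>) \<longleftrightarrow> \<not> sat M e \<phi>"
| "sat M e (And \<phi> \<psi>) \<longleftrightarrow> sat M e \<phi> \<and> sat M e \<psi>"
| "sat M e (Conj \<Phi>) \<longleftrightarrow> (\<forall>n. sat M e (\<Phi> n))"
| "sat M e (All v \<phi>) \<longleftrightarrow> (\<forall>a. sat M (e(v := a)) \<phi>)"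

definition Mod :: "'s lang \<Rightarrow> 's fm set \<Rightarrow> 's struc set" where
  "Mod L T = {M \<in> Str L. \<forall>\<phi> \<in> T. \<forall>e. sat M e \<phi>}"

definition iso :: "'s lang \<Rightarrow> 's struc \<Rightarrow> 's struc \<Rightarrow> bool" where
  "iso L M N \<longleftrightarrow> (\<exists>h. bij h \<and>
     (\<forall>s \<in> rels L. \<forall>xs. length xs = rel_ar L s \<longrightarrow> fst N s (map h xs) = fst M s xs) \<and>
     (\<forall>s \<in> funs L. \<forall>xs. length xs = fun_ar L s \<longrightarrow> snd N s (map h xs) = h (snd M s xs)))"


section \<open>Borel reductions and Borel completeness\<close>

definition borel_reduction ::
    "'s lang \<Rightarrow> 's fm set \<Rightarrow> 't lang \<Rightarrow> 't fm set \<Rightarrow> ('s struc \<Rightarrow> 't struc) \<Rightarrow> bool" where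
  "borel_reduction L S L' T f \<longleftrightarrow>
     f \<in> measurable (restrict_space borel (Mod L S)) (restrict_space borel (Mod L' T)) \<and>
     (\<forall>M \<in> Mod L S. \<forall>N \<in> Mod L S. iso L M N \<longleftrightarrow> iso L' (f M) (f N))"

text \<open>
  Up to renaming of symbols, a countable language is one whose symbols are natural numbers
  (relation and function symbols are kept apart by the syntax, so the two sets may overlap).
\<close>
definition borel_complete :: "'t lang \<Rightarrow> 't fm set \<Rightarrow> bool" where
  "borel_complete L' T \<longleftrightarrow>
     (\<forall>(L :: nat lang). \<forall>\<Phi> \<in> sentences L. \<exists>f. borel_reduction L {\<Phi>} L' T f)"


section \<open>The class of triples \<open>(P, \<le>, \<delta>)\<close>\<close>

text \<open>The order is a set \<open>r\<close> of pairs: \<open>(p, q) \<in> r\<close> means \<open>p \<le> q\<close>.\<close>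

definition in_PP :: "'a set \<Rightarrow> 'a rel \<Rightarrow> ('a \<Rightarrow> nat) \<Rightarrow> bool" where
  "in_PP P r \<delta> \<longleftrightarrow> countable P \<and> partial_order_on P r \<and>
     (\<forall>p \<in> P. finite {q \<in> P. (q, p) \<in> r}) \<and> (\<forall>p \<in> P. \<delta> p \<notin> {0, 1})"

definition bdd :: "'a rel \<Rightarrow> ('a \<Rightarrow> nat) \<Rightarrow> 'a set \<Rightarrow> bool" where
  "bdd r \<delta> Q \<longleftrightarrow> (\<exists>m. (\<forall>q \<in> Q. \<delta> q \<le> m) \<and>
     (\<forall>C. C \<subseteq> Q \<and> C \<in> Chains r \<longrightarrow> finite C \<and> card C \<le> m))"

definition downward_closed :: "'a set \<Rightarrow> 'a rel \<Rightarrow> 'a set \<Rightarrow> bool" where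
  "downward_closed P r Q \<longleftrightarrow> Q \<subseteq> P \<and> (\<forall>q \<in> Q. \<forall>p \<in> P. (p, q) \<in> r \<longrightarrow> p \<in> Q)"

definition minimally_unbounded :: "'a set \<Rightarrow> 'a rel \<Rightarrow> ('a \<Rightarrow> nat) \<Rightarrow> bool" where
  "minimally_unbounded P r \<delta> \<longleftrightarrow> \<not> bdd r \<delta> P \<and>
     (\<forall>Q. downward_closed P r Q \<longrightarrow> bdd r \<delta> Q \<or> bdd r \<delta> (P - Q))"


section \<open>The theory \<open>T(P, \<le>, \<delta>)\<close>\<close>

definition lang_P :: "'a set \<Rightarrow> 'a lang" where
  "lang_P P = \<lparr>rels = P, rel_ar = (\<lambda>_. 2), funs = {}, fun_ar = (\<lambda>_. 0)\<rparr>"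

definition Tru :: "'s fm" where "Tru = All 0 (Eq (Var 0) (Var 0))"
definition Imp :: "'s fm \<Rightarrow> 's fm \<Rightarrow> 's fm" where "Imp \<phi> \<psi> = Neg (And \<phi> (Neg \<psi>))"
definition ExF :: "nat \<Rightarrow> 's fm \<Rightarrow> 's fm" where "ExF v \<phi> = Neg (All v (Neg \<phi>))"
definition ands :: "'s fm list \<Rightarrow> 's fm" where "ands \<phi>s = foldr And \<phi>s Tru"
definition ors :: "'s fm list \<Rightarrow> 's fm" where "ors \<phi>s = Neg (ands (map Neg \<phi>s))"
definition alls :: "nat list \<Rightarrow> 's fm \<Rightarrow> 's fm" where "alls vs \<phi> = foldr All vs \<phi>"
definition exs :: "nat list \<Rightarrow> 's fm \<Rightarrow> 's fm" where "exs vs \<phi> = foldr ExF vs \<phi>"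

definition Efm :: "'a \<Rightarrow> nat \<Rightarrow> nat \<Rightarrow> 'a fm" where
  "Efm q i j = Rel q [Var i, Var j]"

text \<open>For a list \<open>qs\<close> enumerating the elements strictly below \<open>q\<close>, \<open>E_list qs\<close> is \<open>E\<^bsub><q\<^esub>\<close>.\<close>
definition E_list :: "'a list \<Rightarrow> nat \<Rightarrow> nat \<Rightarrow> 'a fm" where
  "E_list qs i j = ands (map (\<lambda>q'. Efm q' i j) qs)"

definition ax_equiv :: "'a \<Rightarrow> 'a fm set" where
  "ax_equiv q =
     {alls [0] (Efm q 0 0),
      alls [0, 1] (Imp (Efm q 0 1) (Efm q 1 0)),
      alls [0, 1, 2] (Imp (And (Efm q 0 1) (Efm q 1 2)) (Efm q 0 2))}"

definition ax_refines :: "'a \<Rightarrow> 'a \<Rightarrow> 'a fm" where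
  "ax_refines q q' = alls [0, 1] (Imp (Efm q 0 1) (Efm q' 0 1))"

text \<open>
  The \<open>E_list qs\<close>-class of variable \<open>0\<close> contains elements (variables \<open>1, \<dots>, d\<close>) that are pairwise
  inequivalent modulo \<open>E\<^bsub>q\<^esub>\<close> and that represent every element (variable \<open>d + 1\<close>) of that class.
\<close>
definition ax_classes :: "'a \<Rightarrow> 'a list \<Rightarrow> nat \<Rightarrow> 'a fm" where
  "ax_classes q qs d =
     alls [0] (exs [1..<Suc d] (And
       (ands (map (\<lambda>i. E_list qs 0 i) [1..<Suc d])) (And
       (ands [Neg (Efm q i j). i \<leftarrow> [1..<Suc d], j \<leftarrow> [1..<Suc d], i \<noteq> j])
       (alls [Suc d]
         (Imp (E_list qs 0 (Suc d)) (ors (map (\<lambda>i. Efm q i (Suc d)) [1..<Suc d])))))))"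

text \<open>
  Here \<open>qs\<close> enumerates a finite downward closed set; the variable \<open>Suc i\<close> is the parameter indexed by
  \<open>qs ! i\<close>, and the variable \<open>0\<close> is the amalgamating element.
\<close>
definition ax_amalg :: "'a rel \<Rightarrow> 'a list \<Rightarrow> 'a fm" where
  "ax_amalg r qs =
     alls [1..<Suc (length qs)] (Imp
       (ands [Efm (qs ! i) (Suc i) (Suc j). i \<leftarrow> [0..<length qs], j \<leftarrow> [0..<length qs],
                (qs ! i, qs ! j) \<in> r])
       (exs [0] (ands (map (\<lambda>i. Efm (qs ! i) 0 (Suc i)) [0..<length qs]))))"

definition T_P :: "'a set \<Rightarrow> 'a rel \<Rightarrow> ('a \<Rightarrow> nat) \<Rightarrow> 'a fm set" where
  "T_P P r \<delta> =
     (\<Union>q \<in> P. ax_equiv q) \<union>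
     {ax_refines q q' | q q'. q \<in> P \<and> q' \<in> P \<and> (q', q) \<in> r} \<union>
     {ax_classes q qs (\<delta> q) | q qs.
        q \<in> P \<and> distinct qs \<and> set qs = {q' \<in> P. (q', q) \<in> r \<and> q' \<noteq> q}} \<union>
     {ax_amalg r qs | qs. distinct qs \<and> downward_closed P r (set qs)}"


section \<open>Sanity checks for \<open>T_P\<close>\<close>

lemma first_order_ands [simp]: "first_order (ands \<phi>s) \<longleftrightarrow> (\<forall>\<phi> \<in> set \<phi>s. first_order \<phi>)"
  by (induction \<phi>s) (auto simp: ands_def Tru_def)

lemma first_order_quants [simp]:
  "first_order (alls vs \<phi>) = first_order \<phi>" "first_order (exs vs \<phi>) = first_order \<phi>"
  by (induction vs) (auto simp: alls_def exs_def ExF_def)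

lemma wf_fm_ands [simp]: "wf_fm L (ands \<phi>s) \<longleftrightarrow> (\<forall>\<phi> \<in> set \<phi>s. wf_fm L \<phi>)"
  by (induction \<phi>s) (auto simp: ands_def Tru_def)

lemma wf_fm_quants [simp]:
  "wf_fm L (alls vs \<phi>) = wf_fm L \<phi>" "wf_fm L (exs vs \<phi>) = wf_fm L \<phi>"
  by (induction vs) (auto simp: alls_def exs_def ExF_def)

lemma fv_ands [simp]: "fv (ands \<phi>s) = (\<Union>\<phi> \<in> set \<phi>s. fv \<phi>)"
  by (induction \<phi>s) (auto simp: ands_def Tru_def)

lemma fv_quants [simp]:
  "fv (alls vs \<phi>) = fv \<phi> - set vs" "fv (exs vs \<phi>) = fv \<phi> - set vs"
  by (induction vs) (auto simp: alls_def exs_def ExF_def)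

lemma sat_ands [simp]: "sat M e (ands \<phi>s) \<longleftrightarrow> (\<forall>\<phi> \<in> set \<phi>s. sat M e \<phi>)"
  by (induction \<phi>s) (auto simp: ands_def Tru_def)

lemma sat_ors [simp]: "sat M e (ors \<phi>s) \<longleftrightarrow> (\<exists>\<phi> \<in> set \<phi>s. sat M e \<phi>)"
  by (auto simp: ors_def)

lemma sat_Imp [simp]: "sat M e (Imp \<phi> \<psi>) \<longleftrightarrow> (sat M e \<phi> \<longrightarrow> sat M e \<psi>)"
  by (auto simp: Imp_def)

lemma sat_ExF [simp]: "sat M e (ExF v \<phi>) \<longleftrightarrow> (\<exists>a. sat M (e(v := a)) \<phi>)"
  by (auto simp: ExF_def)

lemma sat_Efm [simp]: "sat M e (Efm q i j) \<longleftrightarrow> fst M q [e i, e j]"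
  by (auto simp: Efm_def)

lemma sat_E_list [simp]:
  "sat M e (E_list qs i j) \<longleftrightarrow> (\<forall>q \<in> set qs. fst M q [e i, e j])"
  by (auto simp: E_list_def)

lemma sat_alls: "sat M e (alls vs \<phi>) \<longleftrightarrow> (\<forall>e'. (\<forall>v. v \<notin> set vs \<longrightarrow> e' v = e v) \<longrightarrow> sat M e' \<phi>)"
proof (induction vs arbitrary: e)
  case Nil
  have "(\<forall>v. e' v = e v) \<longleftrightarrow> e' = e" for e' by auto
  then show ?case by (simp add: alls_def)
next
  case (Cons w vs)
  have "sat M e (alls (w # vs) \<phi>) \<longleftrightarrow> (\<forall>a. sat M (e(w := a)) (alls vs \<phi>))"
    by (simp add: alls_def)
  also have "\<dots> \<longleftrightarrow> (\<forall>e'. (\<forall>v. v \<notin> set (w # vs) \<longrightarrow> e' v = e v) \<longrightarrow> sat M e' \<phi>)"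
  proof (intro iffI allI impI)
    fix e' assume h: "\<forall>a. sat M (e(w := a)) (alls vs \<phi>)" and "\<forall>v. v \<notin> set (w # vs) \<longrightarrow> e' v = e v"
    then show "sat M e' \<phi>" using h[rule_format, of "e' w", unfolded Cons] by auto
  next
    fix a assume "\<forall>e'. (\<forall>v. v \<notin> set (w # vs) \<longrightarrow> e' v = e v) \<longrightarrow> sat M e' \<phi>"
    then show "sat M (e(w := a)) (alls vs \<phi>)" unfolding Cons by auto
  qed
  finally show ?case .
qed

lemma sat_alls_UNIV: "(\<forall>e. sat M e (alls vs \<phi>)) \<longleftrightarrow> (\<forall>e. sat M e \<phi>)"
  unfolding sat_alls by blast

lemma sat_all1: "sat M e (alls [v] \<phi>) \<longleftrightarrow> (\<forall>a. sat M (e(v := a)) \<phi>)"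
  by (simp add: alls_def)

lemma exs_alls: "sat M e (exs vs \<phi>) \<longleftrightarrow> \<not> sat M e (alls vs (Neg \<phi>))"
  by (induction vs arbitrary: e) (auto simp: exs_def alls_def)

lemma sat_exs: "sat M e (exs vs \<phi>) \<longleftrightarrow> (\<exists>e'. (\<forall>v. v \<notin> set vs \<longrightarrow> e' v = e v) \<and> sat M e' \<phi>)"
  unfolding exs_alls sat_alls by auto

lemma Imp_simps [simp]:
  "fv (Imp \<phi> \<psi>) = fv \<phi> \<union> fv \<psi>" "wf_fm L (Imp \<phi> \<psi>) \<longleftrightarrow> wf_fm L \<phi> \<and> wf_fm L \<psi>"
  "first_order (Imp \<phi> \<psi>) \<longleftrightarrow> first_order \<phi> \<and> first_order \<psi>"
  by (auto simp: Imp_def)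

lemma ors_simps [simp]:
  "fv (ors \<phi>s) = (\<Union>\<phi> \<in> set \<phi>s. fv \<phi>)" "wf_fm L (ors \<phi>s) \<longleftrightarrow> (\<forall>\<phi> \<in> set \<phi>s. wf_fm L \<phi>)"
  "first_order (ors \<phi>s) \<longleftrightarrow> (\<forall>\<phi> \<in> set \<phi>s. first_order \<phi>)"
  by (auto simp: ors_def)

lemma Efm_simps [simp]:
  "fv (Efm q i j) = {i, j}" "wf_fm (lang_P P) (Efm q i j) \<longleftrightarrow> q \<in> P" "first_order (Efm q i j)"
  by (auto simp: Efm_def lang_P_def)

lemma E_list_simps [simp]:
  "fv (E_list qs i j) = (if qs = [] then {} else {i, j})" "wf_fm (lang_P P) (E_list qs i j) \<longleftrightarrow> set qs \<subseteq> P"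
  "first_order (E_list qs i j)"
  by (auto simp: E_list_def)

lemma T_P_sentences:
  assumes "\<phi> \<in> T_P P r \<delta>"
  shows "\<phi> \<in> sentences (lang_P P)" and "first_order \<phi>"
proof -
  have "\<phi> \<in> sentences (lang_P P) \<and> first_order \<phi>"
    using assms unfolding T_P_def
  proof (elim UnE)
    assume "\<phi> \<in> (\<Union>q \<in> P. ax_equiv q)"
    then show ?thesis by (auto simp: ax_equiv_def sentences_def)
  next
    assume "\<phi> \<in> {ax_refines q q' | q q'. q \<in> P \<and> q' \<in> P \<and> (q', q) \<in> r}"
    then show ?thesis by (auto simp: ax_refines_def sentences_def)
  next
    assume "\<phi> \<in> {ax_classes q qs (\<delta> q) | q qs.
        q \<in> P \<and> distinct qs \<and> set qs = {q' \<in> P. (q', q) \<in> r \<and> q' \<noteq> q}}"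
    then obtain q qs where q: "q \<in> P" "set qs \<subseteq> P" "\<phi> = ax_classes q qs (\<delta> q)" by blast
    have "fv \<phi> = {}"
      unfolding q ax_classes_def by (auto split: if_splits)
    moreover have "wf_fm (lang_P P) \<phi>" "first_order \<phi>"
      unfolding q ax_classes_def using q by auto
    ultimately show ?thesis by (simp add: sentences_def)
  next
    assume "\<phi> \<in> {ax_amalg r qs | qs. distinct qs \<and> downward_closed P r (set qs)}"
    then obtain qs where q: "set qs \<subseteq> P" "\<phi> = ax_amalg r qs"
      by (auto simp: downward_closed_def)
    have "qs ! i \<in> P" if "i < length qs" for i using q(1) that by auto
    then show ?thesis unfolding q ax_amalg_def sentences_def by auto
  qed
  then show "\<phi> \<in> sentences (lang_P P)" and "first_order \<phi>" by auto
qed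

text \<open>The sentences above say what the axioms of \<open>T(P, \<le>, \<delta>)\<close> say.\<close>

lemma sat_ax_equiv:
  "(\<forall>\<phi> \<in> ax_equiv q. \<forall>e. sat M e \<phi>) \<longleftrightarrow> equiv UNIV {(x, y). fst M q [x, y]}"
  (is "?l \<longleftrightarrow> ?r")
proof -
  have "?l \<longleftrightarrow> (\<forall>x. fst M q [x, x]) \<and> (\<forall>x y. fst M q [x, y] \<longrightarrow> fst M q [y, x]) \<and>
    (\<forall>x y z. fst M q [x, y] \<and> fst M q [y, z] \<longrightarrow> fst M q [x, z])"
    by (simp add: ax_equiv_def alls_def)
  also have "\<dots> \<longleftrightarrow> ?r"
    by (simp add: equiv_def refl_on_def sym_def trans_def) blast
  finally show ?thesis .
qed

lemma sat_ax_refines: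
  "(\<forall>e. sat M e (ax_refines q q')) \<longleftrightarrow> (\<forall>x y. fst M q [x, y] \<longrightarrow> fst M q' [x, y])"
  by (simp add: ax_refines_def alls_def)

lemma sat_ax_classes:
  assumes eq: "\<And>q'. q' \<in> insert q (set qs) \<Longrightarrow> equiv UNIV {(x, y). fst M q' [x, y]}"
    and ref: "\<And>q' x y. q' \<in> set qs \<Longrightarrow> fst M q [x, y] \<Longrightarrow> fst M q' [x, y]"
    and d: "d \<noteq> 0"
  shows "(\<forall>e. sat M e (ax_classes q qs d)) \<longleftrightarrow>
    (\<forall>x. card ({y. \<forall>q' \<in> set qs. fst M q' [x, y]} // {(x, y). fst M q [x, y]}) = d)"
proof -
  let ?R = "{(x, y). fst M q [x, y]}"
  let ?A = "\<lambda>x. {y. \<forall>q' \<in> set qs. fst M q' [x, y]}"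
  let ?B = "And
       (ands (map (\<lambda>i. E_list qs 0 i) [1..<Suc d])) (And
       (ands [Neg (Efm q i j). i \<leftarrow> [1..<Suc d], j \<leftarrow> [1..<Suc d], i \<noteq> j])
       (alls [Suc d]
         (Imp (E_list qs 0 (Suc d)) (ors (map (\<lambda>i. Efm q i (Suc d)) [1..<Suc d])))))"
  have eqR: "equiv UNIV ?R" using eq by simp
  have cls: "?R `` {y} = ?R `` {z} \<longleftrightarrow> fst M q [y, z]" for y z
    using eq_equiv_class_iff[OF eqR, of y z] by simp
  have B: "sat M e ?B \<longleftrightarrow> (\<forall>i \<in> {1..d}. e i \<in> ?A (e 0)) \<and>
       (\<forall>i \<in> {1..d}. \<forall>j \<in> {1..d}. i \<noteq> j \<longrightarrow> \<not> fst M q [e i, e j]) \<and>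
       (\<forall>y \<in> ?A (e 0). \<exists>i \<in> {1..d}. fst M q [e i, y])" for e
  proof -
    have S: "set [1..<Suc d] = {1..d}" by auto
    have 1: "sat M e (ands (map (\<lambda>i. E_list qs 0 i) [1..<Suc d])) \<longleftrightarrow>
      (\<forall>i \<in> {1..d}. e i \<in> ?A (e 0))"
      unfolding sat_ands set_map S by simp
    have 2: "sat M e (ands [Neg (Efm q i j). i \<leftarrow> [1..<Suc d], j \<leftarrow> [1..<Suc d], i \<noteq> j]) \<longleftrightarrow>
      (\<forall>i \<in> {1..d}. \<forall>j \<in> {1..d}. i \<noteq> j \<longrightarrow> \<not> fst M q [e i, e j])"
    proof -
      have X: "set [Neg (Efm q i j). i \<leftarrow> [1..<Suc d], j \<leftarrow> [1..<Suc d], i \<noteq> j] =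
        {Neg (Efm q i j) | i j. i \<in> {1..d} \<and> j \<in> {1..d} \<and> i \<noteq> j}"
        unfolding set_concat set_map S
        by (auto simp del: upt_Suc simp: Efm_def Bex_def less_Suc_eq_le split: if_splits)
      have "sat M e (ands [Neg (Efm q i j). i \<leftarrow> [1..<Suc d], j \<leftarrow> [1..<Suc d], i \<noteq> j]) \<longleftrightarrow>
        (\<forall>i \<in> {1..d}. \<forall>j \<in> {1..d}. i \<noteq> j \<longrightarrow> sat M e (Neg (Efm q i j)))"
        unfolding sat_ands X by blast
      then show ?thesis unfolding sat.simps(3) sat_Efm .
    qed
    have 3: "sat M e (alls [Suc d]
         (Imp (E_list qs 0 (Suc d)) (ors (map (\<lambda>i. Efm q i (Suc d)) [1..<Suc d])))) \<longleftrightarrow>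
      (\<forall>y \<in> ?A (e 0). \<exists>i \<in> {1..d}. fst M q [e i, y])"
    proof -
      have "i \<noteq> Suc d" if "i \<in> {1..d}" for i using that by simp
      then show ?thesis
        unfolding sat_all1 sat_Imp sat_ors set_map S by (auto simp: Bex_def)
    qed
    show ?thesis unfolding sat.simps(4) 1 2 3 ..
  qed
  have 1: "(\<forall>e. sat M e (ax_classes q qs d)) \<longleftrightarrow>
    (\<forall>x. \<exists>a. (\<forall>i \<in> {1..d}. a i \<in> ?A x) \<and>
       (\<forall>i \<in> {1..d}. \<forall>j \<in> {1..d}. i \<noteq> j \<longrightarrow> \<not> fst M q [a i, a j]) \<and>
       (\<forall>y \<in> ?A x. \<exists>i \<in> {1..d}. fst M q [a i, y]))" (is "?l \<longleftrightarrow> (\<forall>x. ?r x)")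
  proof
    assume l: ?l
    show "\<forall>x. ?r x"
    proof
      fix x
      have "(\<lambda>_. x)(0 := x) = (\<lambda>_ :: nat. x :: nat)" by auto
      moreover have "sat M ((\<lambda>_. x)(0 := x)) (exs [1..<Suc d] ?B)"
        using l unfolding ax_classes_def sat_all1 by blast
      ultimately have "sat M (\<lambda>_. x) (exs [1..<Suc d] ?B)" by (simp only:)
      then obtain e where e: "\<forall>v. v \<notin> set [1..<Suc d] \<longrightarrow> e v = x"
        and s: "sat M e ?B"
        unfolding sat_exs by (elim exE conjE) (rule that)
      have e0: "e 0 = x" using e by simp
      show "?r x"
        using s unfolding B e0 by (intro exI[of _ e])
    qed
  next
    assume r: "\<forall>x. ?r x"
    show ?l
    proof
      fix e
      have "\<exists>e'. (\<forall>v. v \<notin> set [1..<Suc d] \<longrightarrow> e' v = (e(0 := x)) v) \<and> sat M e' ?B" for x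
      proof -
        obtain a where a: "(\<forall>i \<in> {1..d}. a i \<in> ?A x) \<and>
         (\<forall>i \<in> {1..d}. \<forall>j \<in> {1..d}. i \<noteq> j \<longrightarrow> \<not> fst M q [a i, a j]) \<and>
         (\<forall>y \<in> ?A x. \<exists>i \<in> {1..d}. fst M q [a i, y])"
          using r by blast
        define e' where "e' v = (if v \<in> {1..d} then a v else (e(0 := x)) v)" for v
        have e': "e' 0 = x" "\<And>i. i \<in> {1..d} \<Longrightarrow> e' i = a i" by (simp_all add: e'_def)
        have "sat M e' ?B" unfolding B e'(1) using a e'(2) by simp
        moreover have "\<forall>v. v \<notin> set [1..<Suc d] \<longrightarrow> e' v = (e(0 := x)) v"
          by (auto simp: e'_def)
        ultimately show ?thesis by blast
      qed
      then show "sat M e (ax_classes q qs d)"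
        unfolding ax_classes_def sat_all1 sat_exs by blast
    qed
  qed
  have 2: "?r x \<longleftrightarrow> card (?A x // ?R) = d" for x
  proof
    assume "?r x"
    then obtain a where a: "\<forall>i \<in> {1..d}. a i \<in> ?A x"
      "\<forall>i \<in> {1..d}. \<forall>j \<in> {1..d}. i \<noteq> j \<longrightarrow> \<not> fst M q [a i, a j]"
      "\<forall>y \<in> ?A x. \<exists>i \<in> {1..d}. fst M q [a i, y]" by blast
    have "bij_betw (\<lambda>i. ?R `` {a i}) {1..d} (?A x // ?R)"
      unfolding bij_betw_def
    proof
      show "inj_on (\<lambda>i. ?R `` {a i}) {1..d}"
        unfolding inj_on_def cls using a(2) by blast
      show "(\<lambda>i. ?R `` {a i}) ` {1..d} = ?A x // ?R"
      proof
        show "(\<lambda>i. ?R `` {a i}) ` {1..d} \<subseteq> ?A x // ?R"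
          using a(1) by (blast intro: quotientI)
        show "?A x // ?R \<subseteq> (\<lambda>i. ?R `` {a i}) ` {1..d}"
        proof
          fix X assume "X \<in> ?A x // ?R"
          then obtain y where y: "y \<in> ?A x" "X = ?R `` {y}"
            by (rule quotientE) simp
          then obtain i where "i \<in> {1..d}" "fst M q [a i, y]" using a(3) by blast
          then show "X \<in> (\<lambda>i. ?R `` {a i}) ` {1..d}" using y(2) cls[of "a i" y] by blast
        qed
      qed
    qed
    then show "card (?A x // ?R) = d" using bij_betw_same_card by fastforce
  next
    assume c: "card (?A x // ?R) = d"
    then have "finite (?A x // ?R)" using d card.infinite by force
    then obtain b where b: "bij_betw b {1..d} (?A x // ?R)"
      using ex_bij_betw_nat_finite_1[of "?A x // ?R"] c by blast
    have "\<exists>y. y \<in> ?A x \<and> b i = ?R `` {y}" if "i \<in> {1..d}" for i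
    proof -
      have "b i \<in> ?A x // ?R" using bij_betwE[OF b] that by blast
      then obtain y where "b i = ?R `` {y}" "y \<in> ?A x" by (rule quotientE)
      then show ?thesis by (intro exI[of _ y] conjI)
    qed
    then have "\<forall>i. \<exists>y. i \<in> {1..d} \<longrightarrow> y \<in> ?A x \<and> b i = ?R `` {y}" by blast
    from choice[OF this] obtain a where a: "\<And>i. i \<in> {1..d} \<Longrightarrow> a i \<in> ?A x \<and> b i = ?R `` {a i}" by blast
    show "?r x"
    proof (intro exI[of _ a] conjI ballI impI)
      fix i assume "i \<in> {1..d}" then show "a i \<in> ?A x" using a by blast
    next
      fix i j assume ij: "i \<in> {1..d}" "j \<in> {1..d}" "i \<noteq> j"
      then have "b i \<noteq> b j" using b unfolding bij_betw_def inj_on_def by blast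
      then show "\<not> fst M q [a i, a j]" using a[OF ij(1)] a[OF ij(2)] cls[of "a i" "a j"] by simp
    next
      fix y assume "y \<in> ?A x"
      then have "?R `` {y} \<in> ?A x // ?R" by (rule quotientI)
      then obtain i where i: "i \<in> {1..d}" "b i = ?R `` {y}"
        using b unfolding bij_betw_def by (metis (no_types, lifting) imageE)
      then have "fst M q [a i, y]" using a[OF i(1)] cls[of "a i" y] by simp
      then show "\<exists>i \<in> {1..d}. fst M q [a i, y]" using i(1) by blast
    qed
  qed
  show ?thesis unfolding 1 using 2 by simp
qed

lemma sat_ax_amalg:
  assumes dist: "distinct qs"
  shows "(\<forall>e. sat M e (ax_amalg r qs)) \<longleftrightarrow>
    (\<forall>a. (\<forall>q \<in> set qs. \<forall>q' \<in> set qs. (q', q) \<in> r \<longrightarrow> fst M q' [a q', a q]) \<longrightarrow>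
       (\<exists>b. \<forall>q \<in> set qs. fst M q [b, a q]))"
proof -
  let ?n = "length qs"
  have nth: "(\<forall>q \<in> set qs. Q q) \<longleftrightarrow> (\<forall>i < ?n. Q (qs ! i))" for Q
    by (rule all_set_conv_all_nth)
  have "(\<forall>e. sat M e (ax_amalg r qs)) \<longleftrightarrow>
    (\<forall>e. (\<forall>i < ?n. \<forall>j < ?n. (qs ! i, qs ! j) \<in> r \<longrightarrow> fst M (qs ! i) [e (Suc i), e (Suc j)]) \<longrightarrow>
       (\<exists>b. \<forall>i < ?n. fst M (qs ! i) [b, e (Suc i)]))" (is "?l \<longleftrightarrow> ?m")
  proof -
    have "?l \<longleftrightarrow> (\<forall>e. sat M e (Imp
       (ands [Efm (qs ! i) (Suc i) (Suc j). i \<leftarrow> [0..<length qs], j \<leftarrow> [0..<length qs],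
                (qs ! i, qs ! j) \<in> r])
       (exs [0] (ands (map (\<lambda>i. Efm (qs ! i) 0 (Suc i)) [0..<length qs])))))"
      unfolding ax_amalg_def sat_alls_UNIV ..
    also have "\<dots> \<longleftrightarrow> ?m"
    proof (intro iff_allI, unfold sat_Imp, intro arg_cong2[where f = "(\<longrightarrow>)"])
      fix e
      show "sat M e (ands [Efm (qs ! i) (Suc i) (Suc j). i \<leftarrow> [0..<length qs], j \<leftarrow> [0..<length qs],
                (qs ! i, qs ! j) \<in> r]) \<longleftrightarrow>
        (\<forall>i < ?n. \<forall>j < ?n. (qs ! i, qs ! j) \<in> r \<longrightarrow> fst M (qs ! i) [e (Suc i), e (Suc j)])"
        by (force simp: Ball_def)
      show "sat M e (exs [0] (ands (map (\<lambda>i. Efm (qs ! i) 0 (Suc i)) [0..<length qs]))) \<longleftrightarrow>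
        (\<exists>b. \<forall>i < ?n. fst M (qs ! i) [b, e (Suc i)])"
        by (simp add: exs_def atLeast0LessThan lessThan_def)
    qed
    finally show ?thesis .
  qed
  also have "?m \<longleftrightarrow> (\<forall>a. (\<forall>q \<in> set qs. \<forall>q' \<in> set qs. (q', q) \<in> r \<longrightarrow> fst M q' [a q', a q]) \<longrightarrow>
       (\<exists>b. \<forall>q \<in> set qs. fst M q [b, a q]))" (is "_ \<longleftrightarrow> ?r")
  proof
    assume m: ?m
    show ?r
    proof (intro allI impI)
      fix a assume "\<forall>q \<in> set qs. \<forall>q' \<in> set qs. (q', q) \<in> r \<longrightarrow> fst M q' [a q', a q]"
      then show "\<exists>b. \<forall>q \<in> set qs. fst M q [b, a q]"
        using m[rule_format, of "\<lambda>v. a (qs ! (v - 1))"] unfolding nth by simp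
    qed
  next
    assume r: ?r
    show ?m
    proof (intro allI impI)
      fix e assume h: "\<forall>i < ?n. \<forall>j < ?n. (qs ! i, qs ! j) \<in> r \<longrightarrow> fst M (qs ! i) [e (Suc i), e (Suc j)]"
      define a where "a q = e (Suc (THE i. i < ?n \<and> qs ! i = q))" for q
      have a: "a (qs ! i) = e (Suc i)" if "i < ?n" for i
      proof -
        have "(THE k. k < ?n \<and> qs ! k = qs ! i) = i"
          using that dist by (intro the_equality) (auto simp: nth_eq_iff_index_eq)
        then show ?thesis by (simp add: a_def)
      qed
      show "\<exists>b. \<forall>i < ?n. fst M (qs ! i) [b, e (Suc i)]"
      proof -
        have "\<forall>i < ?n. \<forall>j < ?n. (qs ! j, qs ! i) \<in> r \<longrightarrow> fst M (qs ! j) [a (qs ! j), a (qs ! i)]"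
          using h by (simp add: a)
        then have "\<exists>b. \<forall>i < ?n. fst M (qs ! i) [b, a (qs ! i)]"
          using r unfolding nth by blast
        then show ?thesis by (simp add: a)
      qed
    qed
  qed
  finally show ?thesis .
qed

theorem Mod_T_P:
  assumes "in_PP P r \<delta>"
  shows "M \<in> Mod (lang_P P) (T_P P r \<delta>) \<longleftrightarrow>
    M \<in> Str (lang_P P) \<and>
    (\<forall>q \<in> P. equiv UNIV {(x, y). fst M q [x, y]}) \<and>
    (\<forall>q \<in> P. \<forall>q' \<in> P. (q', q) \<in> r \<longrightarrow> (\<forall>x y. fst M q [x, y] \<longrightarrow> fst M q' [x, y])) \<and>
    (\<forall>q \<in> P. \<forall>x. card ({y. \<forall>q' \<in> P. (q', q) \<in> r \<and> q' \<noteq> q \<longrightarrow> fst M q' [x, y]}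
                         // {(x, y). fst M q [x, y]}) = \<delta> q) \<and>
    (\<forall>Q a. finite Q \<and> downward_closed P r Q \<and>
       (\<forall>q \<in> Q. \<forall>q' \<in> Q. (q', q) \<in> r \<longrightarrow> fst M q' [a q', a q]) \<longrightarrow>
       (\<exists>b. \<forall>q \<in> Q. fst M q [b, a q]))"
proof -
  let ?R = "\<lambda>q. {(x, y). fst M q [x, y]}"
  let ?eq = "\<forall>q \<in> P. equiv UNIV (?R q)"
  let ?ref = "\<forall>q \<in> P. \<forall>q' \<in> P. (q', q) \<in> r \<longrightarrow> (\<forall>x y. fst M q [x, y] \<longrightarrow> fst M q' [x, y])"
  let ?pre = "\<lambda>q. {q' \<in> P. (q', q) \<in> r \<and> q' \<noteq> q}"
  let ?am = "\<lambda>Q. \<forall>a. (\<forall>q \<in> Q. \<forall>q' \<in> Q. (q', q) \<in> r \<longrightarrow> fst M q' [a q', a q]) \<longrightarrow>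
       (\<exists>b. \<forall>q \<in> Q. fst M q [b, a q])"
  have fin: "finite (?pre q)" if "q \<in> P" for q
    by (rule finite_subset[of _ "{q' \<in> P. (q', q) \<in> r}"]) (use assms that in \<open>auto simp: in_PP_def\<close>)
  have "M \<in> Mod (lang_P P) (T_P P r \<delta>) \<longleftrightarrow> M \<in> Str (lang_P P) \<and>
    (\<forall>q \<in> P. \<forall>\<phi> \<in> ax_equiv q. \<forall>e. sat M e \<phi>) \<and>
    (\<forall>q \<in> P. \<forall>q' \<in> P. (q', q) \<in> r \<longrightarrow> (\<forall>e. sat M e (ax_refines q q'))) \<and>
    (\<forall>q \<in> P. \<forall>qs. distinct qs \<and> set qs = ?pre q \<longrightarrow> (\<forall>e. sat M e (ax_classes q qs (\<delta> q)))) \<and>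
    (\<forall>qs. distinct qs \<and> downward_closed P r (set qs) \<longrightarrow> (\<forall>e. sat M e (ax_amalg r qs)))"
    unfolding Mod_def T_P_def by blast
  also have "\<dots> \<longleftrightarrow> M \<in> Str (lang_P P) \<and> ?eq \<and> ?ref \<and>
    (\<forall>q \<in> P. \<forall>x. card ({y. \<forall>q' \<in> ?pre q. fst M q' [x, y]} // ?R q) = \<delta> q) \<and>
    (\<forall>Q. finite Q \<and> downward_closed P r Q \<longrightarrow> ?am Q)"
  proof -
    have c: "(\<forall>qs. distinct qs \<and> set qs = ?pre q \<longrightarrow> (\<forall>e. sat M e (ax_classes q qs (\<delta> q)))) \<longleftrightarrow>
      (\<forall>x. card ({y. \<forall>q' \<in> ?pre q. fst M q' [x, y]} // ?R q) = \<delta> q)" (is "?l \<longleftrightarrow> ?r")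
      if eq: ?eq and ref: ?ref and q: "q \<in> P" for q
    proof -
      have *: "(\<forall>e. sat M e (ax_classes q qs (\<delta> q))) \<longleftrightarrow> ?r" if "set qs = ?pre q" for qs
      proof -
        have "(\<forall>e. sat M e (ax_classes q qs (\<delta> q))) \<longleftrightarrow>
          (\<forall>x. card ({y. \<forall>q' \<in> set qs. fst M q' [x, y]} // ?R q) = \<delta> q)"
        proof (rule sat_ax_classes)
          fix q' assume "q' \<in> insert q (set qs)"
          then show "equiv UNIV (?R q')" using eq q that by auto
        next
          fix q' x y assume "q' \<in> set qs" "fst M q [x, y]"
          then show "fst M q' [x, y]" using ref q that by auto
        next
          show "\<delta> q \<noteq> 0" using assms q by (auto simp: in_PP_def)
        qed
        then show ?thesis unfolding that .
      qed
      obtain qs where "distinct qs" "set qs = ?pre q"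
        using finite_distinct_list[OF fin[OF q]] by blast
      then show ?thesis using * by blast
    qed
    have d: "(\<forall>qs. distinct qs \<and> downward_closed P r (set qs) \<longrightarrow> (\<forall>e. sat M e (ax_amalg r qs))) \<longleftrightarrow>
      (\<forall>Q. finite Q \<and> downward_closed P r Q \<longrightarrow> ?am Q)" (is "?l \<longleftrightarrow> ?r")
    proof
      assume l: ?l
      show ?r
      proof (intro allI impI, elim conjE)
        fix Q a assume Q: "finite Q" "downward_closed P r Q"
          and a: "\<forall>q \<in> Q. \<forall>q' \<in> Q. (q', q) \<in> r \<longrightarrow> fst M q' [a q', a q]"
        obtain qs where qs: "set qs = Q" "distinct qs" using finite_distinct_list[OF Q(1)] by blast
        then have "\<forall>e. sat M e (ax_amalg r qs)" using l Q by blast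
        then show "\<exists>b. \<forall>q \<in> Q. fst M q [b, a q]"
          unfolding sat_ax_amalg[OF qs(2)] qs(1) using a by blast
      qed
    next
      assume r: ?r
      show ?l
      proof (intro allI, rule impI)
        fix qs assume "distinct qs \<and> downward_closed P r (set qs)"
        then have "distinct qs" "?am (set qs)" using r by auto
        then show "\<forall>e. sat M e (ax_amalg r qs)" using sat_ax_amalg[of qs M r] by blast
      qed
    qed
    show ?thesis
      unfolding sat_ax_equiv sat_ax_refines d by (intro refl conj_cong ball_cong c; assumption)
  qed
  also have "\<dots> \<longleftrightarrow> M \<in> Str (lang_P P) \<and> ?eq \<and> ?ref \<and>
    (\<forall>q \<in> P. \<forall>x. card ({y. \<forall>q' \<in> P. (q', q) \<in> r \<and> q' \<noteq> q \<longrightarrow> fst M q' [x, y]} // ?R q) = \<delta> q) \<and>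
    (\<forall>Q a. finite Q \<and> downward_closed P r Q \<and>
       (\<forall>q \<in> Q. \<forall>q' \<in> Q. (q', q) \<in> r \<longrightarrow> fst M q' [a q', a q]) \<longrightarrow>
       (\<exists>b. \<forall>q \<in> Q. fst M q [b, a q]))"
  proof -
    have "{y. \<forall>q' \<in> ?pre q. fst M q' [x, y]} =
      {y. \<forall>q' \<in> P. (q', q) \<in> r \<and> q' \<noteq> q \<longrightarrow> fst M q' [x, y]}" for q x by blast
    moreover have "(\<forall>Q. finite Q \<and> downward_closed P r Q \<longrightarrow> ?am Q) \<longleftrightarrow>
      (\<forall>Q a. finite Q \<and> downward_closed P r Q \<and>
       (\<forall>q \<in> Q. \<forall>q' \<in> Q. (q', q) \<in> r \<longrightarrow> fst M q' [a q', a q]) \<longrightarrow>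
       (\<exists>b. \<forall>q \<in> Q. fst M q [b, a q]))" by blast
    ultimately show ?thesis by simp
  qed
  finally show ?thesis .
qed

end

theory Submission
  imports Defs
begin


text \<open>
  Let \<open>Q\<close> be downward closed with \<open>Q\<close> and \<open>P - Q\<close> unbounded. Unboundedness supplies on either side
  infinitely many disjoint finite blocks, each a chain or a single element with large \<open>\<delta>\<close>, on which
  every isometry of the finite binary tree of a given height acts through automorphisms of the
  equivalence relations \<open>E\<^bsub>p\<^esub>\<close>. The blocks of a slot \<open>i\<close> thus store longer and longer prefixes of a
  branch of \<open>2\<^sup>\<omega>\<close>. The branches used fall into countably many dense colour classes, and a back and
  forth argument realises every permutation of the colours by an isometry.

  A model is given by a countable dense set of points of \<open>\<Prod>p. \<delta> p\<close> together with multiplicities.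
  Points that vanish on \<open>Q\<close> and store the branches \<open>b\<^sub>0, \<dots>, b\<^sub>m\<close> on \<open>P - Q\<close> express in their
  multiplicity whether the list of the colours of these branches satisfies a given predicate of lists
  of natural numbers; such predicates encode arbitrary countable structures. An isomorphism has to
  respect each slot of such points separately. This is forced by marker points: for a block \<open>j\<close> in
  \<open>P - Q\<close> and a branch \<open>b\<close> stored on \<open>Q\<close>, the multiplicity says whether the value at \<open>j\<close> is a prefix
  of \<open>b\<close>. Markers can vanish on the finitely many elements of \<open>Q\<close> below \<open>j\<close> and so be compared at
  \<open>j\<close> with points vanishing on \<open>Q\<close>, while two markers with the same restriction to \<open>Q\<close> test the same
  branch.
\<close>

section \<open>Coloured branches and isometries\<close>

definition agree :: "nat \<Rightarrow> (nat \<Rightarrow> bool) \<Rightarrow> (nat \<Rightarrow> bool) \<Rightarrow> bool" where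
  "agree n a b \<longleftrightarrow> (\<forall>j < n. a j = b j)"

text \<open>These are the 1-Lipschitz self-maps of Cantor space for its usual ultrametric. Two
  mutually inverse ones amount to an automorphism of the full binary tree.\<close>

definition nonexpansive :: "((nat \<Rightarrow> bool) \<Rightarrow> (nat \<Rightarrow> bool)) \<Rightarrow> bool" where
  "nonexpansive g \<longleftrightarrow> (\<forall>n a b. agree n a b \<longrightarrow> agree n (g a) (g b))"

abbreviation zero_branch :: "nat \<Rightarrow> bool" where
  "zero_branch \<equiv> \<lambda>_. False"

text \<open>A colour is a tail, here the indicator of the multiples of \<open>Suc k\<close>.
  Prescribing only tails makes each class countable and dense; different moduli keep the classes
  disjoint, and since no such tail is eventually zero, the zero branch has no colour.\<close>

definition coloured :: "nat \<Rightarrow> (nat \<Rightarrow> bool) set" where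
  "coloured k = {b. \<exists>m. \<forall>j \<ge> m. b j \<longleftrightarrow> Suc k dvd j}"

lemma agree_refl [simp]: "agree n a a"
  by (simp add: agree_def)

lemma agree_sym: "agree n a b \<Longrightarrow> agree n b a"
  by (simp add: agree_def)

lemma agree_trans: "agree n a b \<Longrightarrow> agree n b c \<Longrightarrow> agree n a c"
  by (simp add: agree_def)

lemma agree_mono: "agree n a b \<Longrightarrow> m \<le> n \<Longrightarrow> agree m a b"
  by (simp add: agree_def)

lemma agree_Suc: "agree (Suc n) a b \<longleftrightarrow> agree n a b \<and> a n = b n"
  by (auto simp: agree_def less_Suc_eq)

lemma agree_imp_eq:
  assumes "\<And>m. \<exists>n \<ge> m. agree n a b"
  shows "a = b"
proof
  fix j show "a j = b j" using assms[of "Suc j"] by (auto simp: agree_def)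
qed

lemma coloured_unique:
  assumes "b \<in> coloured k" "b \<in> coloured l"
  shows "k = l"
proof -
  obtain m n where m: "\<And>j. j \<ge> m \<Longrightarrow> b j \<longleftrightarrow> Suc k dvd j" and n: "\<And>j. j \<ge> n \<Longrightarrow> b j \<longleftrightarrow> Suc l dvd j"
    using assms unfolding coloured_def by blast
  have e: "Suc k dvd j \<longleftrightarrow> Suc l dvd j" if "j \<ge> m + n" for j
    using m[of j] n[of j] that by simp
  have *: "Suc k' dvd Suc l'"
    if "\<And>j. j \<ge> m + n \<Longrightarrow> Suc l' dvd j \<Longrightarrow> Suc k' dvd j" for k' l'
  proof -
    \<comment> \<open>Two consecutive multiples of \<open>Suc l'\<close> beyond the threshold are
      both multiples of \<open>Suc k'\<close>, hence so is their difference.\<close>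
    have "m + n \<le> (m + n) * Suc l'" by simp
    then have "Suc k' dvd (m + n) * Suc l'" "Suc k' dvd (m + n) * Suc l' + Suc l'"
      using dvd_triv_right[of "Suc l'" "m + n"] by (blast intro: that, intro that dvd_add) auto
    then show ?thesis by (simp only: dvd_add_right_iff)
  qed
  have "Suc k dvd Suc l" by (rule *) (use e in blast)
  moreover have "Suc l dvd Suc k" by (rule *) (use e in blast)
  ultimately show ?thesis using dvd_antisym by blast
qed

lemma zero_not_coloured: "zero_branch \<notin> coloured k"
proof
  assume "zero_branch \<in> coloured k"
  then obtain m where m: "\<And>j. j \<ge> m \<Longrightarrow> \<not> Suc k dvd j"
    unfolding coloured_def by blast
  have "m \<le> m * Suc k" "Suc k dvd m * Suc k" by (simp, rule dvd_triv_right)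
  then show False using m by blast
qed

lemma coloured_dense: "\<exists>b \<in> coloured k. agree n b a"
proof
  let ?b = "\<lambda>j. if j < n then a j else Suc k dvd j"
  show "?b \<in> coloured k" unfolding coloured_def by (auto intro: exI[of _ n])
  show "agree n ?b a" by (simp add: agree_def)
qed

text \<open>Such a function is determined by the finite subset of \<open>A \<times> V\<close> that
  records where and how it departs from \<open>f\<close>. This serves for colour classes, for
  \<open>codes\<close> and for \<open>D\<close>.\<close>

lemma countable_finite_modifications:
  fixes f :: "'b \<Rightarrow> 'c"
  assumes A: "countable A" and V: "countable V"
  shows "countable {x. finite {i. x i \<noteq> f i} \<and> {i. x i \<noteq> f i} \<subseteq> A \<and> (\<forall>i. x i \<noteq> f i \<longrightarrow> x i \<in> V)}"
    (is "countable ?S")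
proof -
  let ?g = "\<lambda>x. (\<lambda>i. (i, x i)) ` {i. x i \<noteq> f i}"
  have "?g ` ?S \<subseteq> {F. finite F \<and> F \<subseteq> A \<times> V}" by auto
  moreover have "countable {F. finite F \<and> F \<subseteq> A \<times> V}"
    using A V by (intro countable_Collect_finite_subset countable_SIGMA)
  ultimately have "countable (?g ` ?S)" by (rule countable_subset)
  moreover have "inj_on ?g ?S"
  proof (rule inj_onI, rule ext)
    fix x y i assume e: "?g x = ?g y"
    show "x i = y i"
    proof (cases "x i = f i")
      case True
      then have "(i, y i) \<notin> ?g y" unfolding e[symmetric] by auto
      then show ?thesis using True by auto
    next
      case False
      then have "(i, x i) \<in> ?g y" unfolding e[symmetric] by auto
      then show ?thesis by auto
    qed
  qed
  ultimately show ?thesis by (rule countable_image_inj_on)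
qed

lemma countable_coloured: "countable (coloured k)"
proof (rule countable_subset)
  let ?f = "\<lambda>j. Suc k dvd j"
  show "countable {x. finite {i. x i \<noteq> ?f i} \<and> {i. x i \<noteq> ?f i} \<subseteq> UNIV \<and> (\<forall>i. x i \<noteq> ?f i \<longrightarrow> x i \<in> UNIV)}"
    by (rule countable_finite_modifications) auto
  show "coloured k \<subseteq> {x. finite {i. x i \<noteq> ?f i} \<and> {i. x i \<noteq> ?f i} \<subseteq> UNIV \<and> (\<forall>i. x i \<noteq> ?f i \<longrightarrow> x i \<in> UNIV)}"
  proof
    fix x assume "x \<in> coloured k"
    then obtain m where "\<And>j. j \<ge> m \<Longrightarrow> x j = ?f j" unfolding coloured_def by blast
    then have "{i. x i \<noteq> ?f i} \<subseteq> {..<m}" using leI by blast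
    then show "x \<in> {x. finite {i. x i \<noteq> ?f i} \<and> {i. x i \<noteq> ?f i} \<subseteq> UNIV \<and> (\<forall>i. x i \<noteq> ?f i \<longrightarrow> x i \<in> UNIV)}"
      using finite_subset by auto
  qed
qed

section \<open>Partial isometries and back and forth\<close>

definition partial_isometry :: "(nat \<Rightarrow> nat) \<Rightarrow> ((nat \<Rightarrow> bool) \<times> (nat \<Rightarrow> bool)) set \<Rightarrow> bool" where
  "partial_isometry h f \<longleftrightarrow> (zero_branch, zero_branch) \<in> f \<and>
     (\<forall>a b a' b' n. (a, b) \<in> f \<longrightarrow> (a', b') \<in> f \<longrightarrow> (agree n a a' \<longleftrightarrow> agree n b b')) \<and>
     (\<forall>a b. (a, b) \<in> f \<longrightarrow> a \<noteq> zero_branch \<longrightarrow> (\<exists>k. a \<in> coloured k \<and> b \<in> coloured (h k)))"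

lemma partial_isometry_agree:
  "partial_isometry h f \<Longrightarrow> (a, b) \<in> f \<Longrightarrow> (a', b') \<in> f \<Longrightarrow> agree n a a' \<longleftrightarrow> agree n b b'"
  unfolding partial_isometry_def by blast

lemma partial_isometry_unique:
  assumes "partial_isometry h f" "(a, b) \<in> f" "(a, b') \<in> f"
  shows "b = b'"
  using partial_isometry_agree[OF assms] by (intro agree_imp_eq) auto

text \<open>Turns the back step into a forth step for the inverse permutation of colours.\<close>

lemma partial_isometry_converse:
  assumes f: "partial_isometry h f" and h: "\<And>k. h' (h k) = k"
  shows "partial_isometry h' (f\<inverse>)"
  unfolding partial_isometry_def
proof (intro conjI)
  show z: "(zero_branch, zero_branch) \<in> f\<inverse>"
    using f unfolding partial_isometry_def by blast
  show "\<forall>a b a' b' n. (a, b) \<in> f\<inverse> \<longrightarrow> (a', b') \<in> f\<inverse> \<longrightarrow> (agree n a a' \<longleftrightarrow> agree n b b')"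
    using partial_isometry_agree[OF f] by simp
  show "\<forall>a b. (a, b) \<in> f\<inverse> \<longrightarrow> a \<noteq> zero_branch \<longrightarrow> (\<exists>k. a \<in> coloured k \<and> b \<in> coloured (h' k))"
  proof (intro allI impI, unfold converse_iff)
    fix a b assume ba: "(b, a) \<in> f" and a: "a \<noteq> zero_branch"
    then have "b \<noteq> zero_branch" using partial_isometry_unique[OF f ba] z by blast
    then obtain k where "b \<in> coloured k" "a \<in> coloured (h k)"
      using f ba unfolding partial_isometry_def by blast
    then show "\<exists>k. a \<in> coloured k \<and> b \<in> coloured (h' k)" using h by metis
  qed
qed

text \<open>
  The image of \<open>a\<close> leaves the image of a nearest point \<open>a1\<close> of the domain exactly where \<open>a\<close> leaves
  \<open>a1\<close>; binary branching then gives the right distance to all other points.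
\<close>
lemma partial_isometry_extend:
  assumes f: "partial_isometry h f" "finite f" and a: "a = zero_branch \<or> a \<in> coloured k"
  shows "\<exists>b. partial_isometry h (insert (a, b) f)"
proof (cases "a \<in> Domain f")
  case True
  then obtain b where "(a, b) \<in> f" by blast
  then show ?thesis using f by (metis insert_absorb)
next
  case False
  have z: "(zero_branch, zero_branch) \<in> f" using f unfolding partial_isometry_def by blast
  then have a0: "a \<noteq> zero_branch" "a \<in> coloured k" using False a by auto
  define d where "d c = (LEAST j. a j \<noteq> c j)" for c
  have d: "agree n a c \<longleftrightarrow> n \<le> d c" if "(c, b) \<in> f" for c b n
  proof -
    have "a \<noteq> c" using that False by blast
    then obtain j where "a j \<noteq> c j" by blast
    then have "a (d c) \<noteq> c (d c)" unfolding d_def by (rule LeastI)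
    moreover have "a j = c j" if "j < d c" for j
      using not_less_Least[OF that[unfolded d_def]] by blast
    ultimately show ?thesis unfolding agree_def by (metis leD leI less_le_trans)
  qed
  define m where "m = Max ((d \<circ> fst) ` f)"
  have "m \<in> (d \<circ> fst) ` f" unfolding m_def using f z by (intro Max_in) auto
  then obtain a1 b1 where 1: "(a1, b1) \<in> f" "m = d a1" by force
  have max: "d c \<le> m" if "(c, b) \<in> f" for c b
    unfolding m_def using f that by (intro Max_ge) force+
  \<comment> \<open>Leaving \<open>b1\<close> exactly at level \<open>m\<close> determines the first
    \<open>Suc m\<close> entries of \<open>b\<close>; density of the colour class \<open>h k\<close>
    supplies a branch with this beginning.\<close>
  obtain b where b: "b \<in> coloured (h k)" "agree (Suc m) b (b1(m := \<not> b1 m))"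
    using coloured_dense by blast
  have b': "agree m b b1" "b m \<noteq> b1 m" using b(2) by (auto simp: agree_def)
  have am: "agree m a a1" "a m \<noteq> a1 m"
    using d[OF 1(1)] 1(2) agree_Suc[of m a a1] by auto
  have key: "agree n a c \<longleftrightarrow> agree n b e" if ce: "(c, e) \<in> f" for n c e
  proof (cases "n \<le> m")
    case True
    have "agree n a c \<longleftrightarrow> agree n a1 c"
      using agree_mono[OF am(1) True] by (simp add: agree_def)
    also have "\<dots> \<longleftrightarrow> agree n b1 e" using partial_isometry_agree[OF f(1) 1(1) ce] .
    also have "\<dots> \<longleftrightarrow> agree n b e"
      using agree_mono[OF b'(1) True] by (simp add: agree_def)
    finally show ?thesis .
  next
    case n: False
    have no: "\<not> agree (Suc m) a c" using d[OF ce] max[OF ce] by simp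
    \<comment> \<open>If \<open>e\<close> followed \<open>b\<close> through level \<open>m\<close>,
      it would leave \<open>b1\<close> there, so \<open>c\<close> would leave \<open>a1\<close> at
      level \<open>m\<close>. As there are only two values, \<open>c\<close> would then follow
      \<open>a\<close> through level \<open>m\<close>, against the maximality of
      \<open>m\<close>.\<close>
    have "\<not> agree (Suc m) b e"
    proof
      assume e: "agree (Suc m) b e"
      have 2: "agree m b1 e" using e b'(1) by (simp add: agree_def)
      have 3: "\<not> agree (Suc m) b1 e" using e b'(2) by (auto simp: agree_Suc)
      have 4: "agree m a1 c" "\<not> agree (Suc m) a1 c"
        using 2 3 partial_isometry_agree[OF f(1) 1(1) ce] by auto
      then have "a m = c m" using am(2) by (auto simp: agree_Suc)
      moreover have "agree m a c" using agree_trans[OF am(1) 4(1)] .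
      ultimately show False using no by (simp add: agree_Suc)
    qed
    then show ?thesis using no n agree_mono[of n _ _ "Suc m"] by force
  qed
  have "partial_isometry h (insert (a, b) f)"
    unfolding partial_isometry_def
  proof (intro conjI)
    show "(zero_branch, zero_branch) \<in> insert (a, b) f" using z by blast
    show "\<forall>x y x' y' n. (x, y) \<in> insert (a, b) f \<longrightarrow> (x', y') \<in> insert (a, b) f \<longrightarrow>
        (agree n x x' \<longleftrightarrow> agree n y y')"
    proof (intro allI impI, elim insertE, goal_cases)
      case (1 x y x' y' n)
      then show ?case by simp
    next
      case (2 x y x' y' n)
      then show ?case using key by simp
    next
      case (3 x y x' y' n)
      then show ?case using key[of x y n] by (simp add: agree_def eq_commute)

    next
      case (4 x y x' y' n)
      then show ?case using partial_isometry_agree[OF f(1)] by blast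
    qed
    show "\<forall>x y. (x, y) \<in> insert (a, b) f \<longrightarrow> x \<noteq> zero_branch \<longrightarrow> (\<exists>k. x \<in> coloured k \<and> y \<in> coloured (h k))"
      using f(1) a0(2) b(1) unfolding partial_isometry_def by blast
  qed
  then show ?thesis by blast
qed

text \<open>Back and forth along an enumeration \<open>e\<close> of the zero branch and all coloured
  branches: each stage is a finite partial isometry, and stage \<open>n\<close> puts
  \<open>e n\<close> into both domain and range.\<close>

lemma colour_permutation_partial_isometry:
  assumes h: "bij h"
  shows "\<exists>f. partial_isometry h f \<and>
    (\<forall>b k. b = zero_branch \<or> b \<in> coloured k \<longrightarrow> b \<in> Domain f \<and> b \<in> Range f)"
proof -
  define B where "B = insert zero_branch (\<Union>k. coloured k)"
  have cB: "countable B" "B \<noteq> {}" unfolding B_def using countable_coloured by auto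
  define e where "e = from_nat_into B"
  have eB: "e n \<in> B" for n unfolding e_def using from_nat_into[OF cB(2)] .
  have surj: "\<exists>n. e n = b" if "b \<in> B" for b
    unfolding e_def using from_nat_into_surj[OF cB(1) that] .
  have inv: "\<And>k. inv h (h k) = k" "\<And>k. h (inv h k) = k"
    using h by (simp_all add: bij_is_inj bij_is_surj surj_f_inv_f)
  define good where "good f \<longleftrightarrow> finite f \<and> partial_isometry h f" for f
  have "\<exists>f. \<forall>n. good (f n) \<and> (f n \<subseteq> f (Suc n) \<and> e n \<in> Domain (f (Suc n)) \<and> e n \<in> Range (f (Suc n)))"
  proof (rule dependent_nat_choice)
    show "\<exists>f. good f"
      by (rule exI[of _ "{(zero_branch, zero_branch)}"])
        (auto simp: good_def partial_isometry_def)
  next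
    fix f n assume f: "good f"
    have en: "e n = zero_branch \<or> (\<exists>k. e n \<in> coloured k)" using eB[of n] unfolding B_def by blast
    obtain b where b: "partial_isometry h (insert (e n, b) f)"
      using partial_isometry_extend f en unfolding good_def by metis
    obtain c where c: "partial_isometry (inv h) (insert (e n, c) ((insert (e n, b) f)\<inverse>))"
      using partial_isometry_extend[OF partial_isometry_converse[OF b inv(1)]] f en
      unfolding good_def by (metis finite.insertI finite_converse)
    have "(insert (e n, c) ((insert (e n, b) f)\<inverse>))\<inverse> = insert (c, e n) (insert (e n, b) f)" by auto
    then have "good (insert (c, e n) (insert (e n, b) f))"
      using partial_isometry_converse[OF c inv(2)] f unfolding good_def by simp
    then show "\<exists>f'. good f' \<and> f \<subseteq> f' \<and> e n \<in> Domain f' \<and> e n \<in> Range f'"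
      by (intro exI[of _ "insert (c, e n) (insert (e n, b) f)"]) auto
  qed
  then obtain f where f: "\<And>n. good (f n)" "\<And>n. f n \<subseteq> f (Suc n)"
    "\<And>n. e n \<in> Domain (f (Suc n))" "\<And>n. e n \<in> Range (f (Suc n))" by blast
  have mono: "f m \<subseteq> f n" if "m \<le> n" for m n using lift_Suc_mono_le[of f, OF f(2) that] .
  have two: "\<exists>n. x \<in> f n \<and> y \<in> f n" if "x \<in> (\<Union>n. f n)" "y \<in> (\<Union>n. f n)" for x y
  proof -
    obtain m n where "x \<in> f m" "y \<in> f n" using \<open>x \<in> _\<close> \<open>y \<in> _\<close> by blast
    then show ?thesis using mono[of m "max m n"] mono[of n "max m n"] by auto
  qed
  have "partial_isometry h (\<Union>n. f n)"
    unfolding partial_isometry_def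
  proof (intro conjI)
    show "(zero_branch, zero_branch) \<in> (\<Union>n. f n)"
      using f(1) unfolding good_def partial_isometry_def by blast
    show "\<forall>a b. (a, b) \<in> (\<Union>n. f n) \<longrightarrow> a \<noteq> zero_branch \<longrightarrow> (\<exists>k. a \<in> coloured k \<and> b \<in> coloured (h k))"
      using f(1) unfolding good_def partial_isometry_def by blast
    show "\<forall>a b a' b' n. (a, b) \<in> (\<Union>n. f n) \<longrightarrow> (a', b') \<in> (\<Union>n. f n) \<longrightarrow> (agree n a a' \<longleftrightarrow> agree n b b')"
    proof (intro allI impI)
      fix a b a' b' n assume "(a, b) \<in> (\<Union>n. f n)" "(a', b') \<in> (\<Union>n. f n)"
      then obtain m where "(a, b) \<in> f m" "(a', b') \<in> f m" using two by blast
      then show "agree n a a' \<longleftrightarrow> agree n b b'"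
        using f(1)[of m] partial_isometry_agree unfolding good_def by blast
    qed
  qed
  moreover have "b \<in> Domain (\<Union>n. f n) \<and> b \<in> Range (\<Union>n. f n)"
    if "b = zero_branch \<or> b \<in> coloured k" for b k
  proof -
    have "b \<in> B" using that unfolding B_def by blast
    then obtain n where "e n = b" using surj by blast
    then show ?thesis using f(3,4)[of n] by blast
  qed
  ultimately show ?thesis by blast
qed

text \<open>The continuous extension of \<open>f\<close> from a dense domain. Entry \<open>n\<close>
  is read off any pair of \<open>f\<close> whose first component shares the first
  \<open>Suc n\<close> entries with \<open>b\<close>; the isometry property makes the choice
  immaterial.\<close>

definition extension :: "((nat \<Rightarrow> bool) \<times> (nat \<Rightarrow> bool)) set \<Rightarrow> (nat \<Rightarrow> bool) \<Rightarrow> nat \<Rightarrow> bool" where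
  "extension f b n = snd (SOME x. x \<in> f \<and> agree (Suc n) (fst x) b) n"

lemma extension_agree:
  assumes f: "partial_isometry h f" and ac: "(a, c) \<in> f" "agree n a b"
  shows "agree n c (extension f b)"
  unfolding agree_def
proof (intro allI impI)
  fix j assume j: "j < n"
  let ?x = "SOME x. x \<in> f \<and> agree (Suc j) (fst x) b"
  have ab: "agree (Suc j) a b" using agree_mono[OF ac(2)] j by simp
  have "?x \<in> f \<and> agree (Suc j) (fst ?x) b"
    by (rule someI[of _ "(a, c)"]) (use ac ab in simp)
  then have "agree (Suc j) a (fst ?x)" "(fst ?x, snd ?x) \<in> f"
    using ab by (simp_all add: agree_def)
  then have "agree (Suc j) c (snd ?x)" using partial_isometry_agree[OF f ac(1)] by blast
  then show "c j = extension f b j" by (simp add: extension_def agree_Suc)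
qed

lemma extension_eq:
  assumes "partial_isometry h f" "(a, c) \<in> f"
  shows "extension f a = c"
  using agree_imp_eq[of c "extension f a"] extension_agree[OF assms, of _ a] by auto

text \<open>Domain and range of the back and forth map contain \<open>coloured 0\<close>, which is
  dense, so the map and its converse extend to the whole tree. Density also makes the two extensions
  mutually inverse.\<close>

lemma colour_permutation_isometry:
  assumes h: "bij h"
  obtains g g' where "nonexpansive g" "nonexpansive g'" "\<And>b. g (g' b) = b" "\<And>b. g' (g b) = b"
    "g zero_branch = zero_branch" "g' zero_branch = zero_branch"
    "\<And>k b. b \<in> coloured k \<Longrightarrow> g b \<in> coloured (h k)" "\<And>k b. b \<in> coloured (h k) \<Longrightarrow> g' b \<in> coloured k"
proof -
  obtain f where f: "partial_isometry h f"
    and dom: "\<And>b k. b = zero_branch \<or> b \<in> coloured k \<Longrightarrow> b \<in> Domain f \<and> b \<in> Range f"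
    using colour_permutation_partial_isometry[OF h] by blast
  have f': "partial_isometry (inv h) (f\<inverse>)"
    using partial_isometry_converse[OF f] h by (simp add: bij_is_inj)
  define g where "g = extension f"
  define g' where "g' = extension (f\<inverse>)"
  have dense: "\<exists>a c. (a, c) \<in> f \<and> agree n a b" "\<exists>a c. (a, c) \<in> f\<inverse> \<and> agree n a b" for n b
    using coloured_dense[of 0 n b] dom by blast+
  have ne: "nonexpansive (extension F)"
    if F: "partial_isometry H F" and dF: "\<And>n b. \<exists>a c. (a, c) \<in> F \<and> agree n a b" for H F
    unfolding nonexpansive_def
  proof (intro allI impI)
    fix n b b' assume b: "agree n b b'"
    obtain a c where ac: "(a, c) \<in> F" "agree n a b" using dF by blast
    then have "agree n a b'" using agree_trans[OF _ b] by blast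
    then show "agree n (extension F b) (extension F b')"
      using agree_trans[OF agree_sym[OF extension_agree[OF F ac]] extension_agree[OF F ac(1)]] by blast
  qed
  have inv: "extension (F\<inverse>) (extension F b) = b"
    if F: "partial_isometry H F" and F': "partial_isometry H' (F\<inverse>)"
      and dF: "\<And>n b. \<exists>a c. (a, c) \<in> F \<and> agree n a b" for H H' F b
  proof (rule agree_imp_eq)
    fix n
    obtain a c where ac: "(a, c) \<in> F" "agree n a b" using dF by blast
    have "agree n a (extension (F\<inverse>) (extension F b))"
      using extension_agree[OF F' _ extension_agree[OF F ac]] ac(1) by blast
    then have "agree n (extension (F\<inverse>) (extension F b)) b" using agree_trans[OF agree_sym ac(2)] by blast
    then show "\<exists>n' \<ge> n. agree n' (extension (F\<inverse>) (extension F b)) b" by blast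
  qed
  have z: "(zero_branch, zero_branch) \<in> f" using f unfolding partial_isometry_def by blast
  have col: "extension F b \<in> coloured (H k)"
    if F: "partial_isometry H F" and b: "b \<in> coloured k" and d: "b \<in> Domain F" for H F b k
  proof -
    obtain c where c: "(b, c) \<in> F" using d by blast
    have "b \<noteq> zero_branch" using zero_not_coloured b by blast
    then obtain l where "b \<in> coloured l" "c \<in> coloured (H l)"
      using F c unfolding partial_isometry_def by blast
    then show ?thesis using coloured_unique[OF b] extension_eq[OF F c] by blast
  qed
  show ?thesis
  proof (rule that[of g g'])
    show "nonexpansive g" "nonexpansive g'"
      unfolding g_def g'_def using ne[OF f dense(1)] ne[OF f' dense(2)] .
    show "g' (g b) = b" for b unfolding g_def g'_def using inv[OF f f' dense(1)] .
    show "g (g' b) = b" for b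
      unfolding g_def g'_def using inv[OF f' _ dense(2)] f by simp
    show "g zero_branch = zero_branch" unfolding g_def using extension_eq[OF f z] .
    show "g' zero_branch = zero_branch" unfolding g'_def using extension_eq[OF f'] z by blast
    show "g b \<in> coloured (h k)" if "b \<in> coloured k" for k b
      unfolding g_def using col[OF f that] dom that by blast
    show "g' b \<in> coloured k" if "b \<in> coloured (h k)" for k b
    proof -
      have "b \<in> Domain (f\<inverse>)" using dom that by blast
      then have "g' b \<in> coloured (inv h (h k))" unfolding g'_def using col[OF f' that] by blast
      then show ?thesis using h by (simp add: bij_is_inj)
    qed
  qed
qed


section \<open>Blocks\<close>

definition cube :: "('a \<Rightarrow> nat) \<Rightarrow> 'a set \<Rightarrow> ('a \<Rightarrow> nat) set" where
  "cube \<delta> C = {x. (\<forall>p \<in> C. x p < \<delta> p) \<and> (\<forall>p. p \<notin> C \<longrightarrow> x p = 0)}"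

text \<open>
  \<open>\<beta>\<close> stores the first \<open>n\<close> entries of a branch in the coordinates of the block \<open>C\<close>. The condition
  on agreement says that \<open>act g\<close> respects all relations \<open>E\<^bsub>p\<^esub>\<close>.
\<close>
locale block =
  fixes P :: "'a set" and r :: "'a rel" and \<delta> :: "'a \<Rightarrow> nat" and n :: nat
    and C :: "'a set" and t :: 'a and \<beta> :: "(nat \<Rightarrow> bool) \<Rightarrow> 'a \<Rightarrow> nat"
    and act :: "((nat \<Rightarrow> bool) \<Rightarrow> (nat \<Rightarrow> bool)) \<Rightarrow> ('a \<Rightarrow> nat) \<Rightarrow> 'a \<Rightarrow> nat"
  assumes fin: "finite C" and sub: "C \<subseteq> P" and top: "t \<in> C" "\<And>q. q \<in> C \<Longrightarrow> (q, t) \<in> r"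
    and code_cube: "\<And>b. \<beta> b \<in> cube \<delta> C"
    and code_zero: "\<And>p. \<beta> zero_branch p = 0"
    and code_eq: "\<And>b b'. \<beta> b = \<beta> b' \<longleftrightarrow> agree n b b'"
    and act_cube: "\<And>g x. nonexpansive g \<Longrightarrow> x \<in> cube \<delta> C \<Longrightarrow> act g x \<in> cube \<delta> C"
    and act_code: "\<And>g b. nonexpansive g \<Longrightarrow> act g (\<beta> b) = \<beta> (g b)"
    and act_agree: "\<And>g F x y p. nonexpansive g \<Longrightarrow> downward_closed P r F \<Longrightarrow> x \<in> cube \<delta> C \<Longrightarrow>
      y \<in> cube \<delta> C \<Longrightarrow> (\<And>q. q \<in> F \<Longrightarrow> x q = y q) \<Longrightarrow> p \<in> F \<Longrightarrow> act g x p = act g y p"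
    and act_inverse: "\<And>g g' x. nonexpansive g \<Longrightarrow> nonexpansive g' \<Longrightarrow> (\<And>b. g' (g b) = b) \<Longrightarrow>
      x \<in> cube \<delta> C \<Longrightarrow> act g' (act g x) = x"

lemma nonexpansiveD: "nonexpansive g \<Longrightarrow> agree n a b \<Longrightarrow> agree n (g a) (g b)"
  by (simp add: nonexpansive_def)

lemma chain_rank:
  assumes r: "partial_order_on P r" and C: "C \<subseteq> P" "C \<in> Chains r" "finite C"
  shows "\<exists>k. bij_betw k C {..<card C} \<and> (\<forall>p \<in> C. \<forall>q \<in> C. (p, q) \<in> r \<longleftrightarrow> k p \<le> k q)"
proof -
  define k where "k p = card {q \<in> C. (q, p) \<in> r \<and> q \<noteq> p}" for p
  have tr: "(a, b) \<in> r \<Longrightarrow> (b, c) \<in> r \<Longrightarrow> (a, c) \<in> r"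
    and an: "(a, b) \<in> r \<Longrightarrow> (b, a) \<in> r \<Longrightarrow> a = b" for a b c
    using r unfolding partial_order_on_def preorder_on_def trans_def antisym_def by blast+
  have lt: "k p < k q" if "p \<in> C" "q \<in> C" "(p, q) \<in> r" "p \<noteq> q" for p q
    unfolding k_def
  proof (rule psubset_card_mono)
    show "{q' \<in> C. (q', p) \<in> r \<and> q' \<noteq> p} \<subset> {q' \<in> C. (q', q) \<in> r \<and> q' \<noteq> q}"
      using that tr an by blast
  qed (use C in simp)
  have tot: "(p, q) \<in> r \<or> (q, p) \<in> r" if "p \<in> C" "q \<in> C" for p q
    using C(2) that unfolding Chains_def by blast
  have iff: "(p, q) \<in> r \<longleftrightarrow> k p \<le> k q" if "p \<in> C" "q \<in> C" for p q
    using lt[OF that] lt[OF that(2,1)] tot[OF that] tot[OF that(1) that(1)] by force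
  have inj: "inj_on k C"
    by (rule inj_onI) (use iff an in auto)
  have "k p < card C" if "p \<in> C" for p
    unfolding k_def by (rule psubset_card_mono) (use that C(3) in auto)
  then have "k ` C \<subseteq> {..<card C}" by blast
  moreover have "card (k ` C) = card {..<card C}" using inj by (simp add: card_image)
  ultimately have "k ` C = {..<card C}" using card_subset_eq by blast
  then show ?thesis using inj iff unfolding bij_betw_def by blast
qed

text \<open>The element of rank \<open>j\<close> in the chain stores entry \<open>j\<close> of a
  branch. Entries of smaller index then sit at smaller elements, so a nonexpansive map acts in such
  a way that the new value at \<open>p\<close> depends only on coordinates at or below
  \<open>p\<close>.\<close>

lemma chain_block:
  assumes P: "in_PP P r \<delta>" and C: "C \<subseteq> P" "C \<in> Chains r" "finite C" "C \<noteq> {}"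
  shows "\<exists>t \<beta> act. block P r \<delta> (card C) C t \<beta> act"
proof -
  obtain k where k: "bij_betw k C {..<card C}"
    and le: "\<And>p q. p \<in> C \<Longrightarrow> q \<in> C \<Longrightarrow> (p, q) \<in> r \<longleftrightarrow> k p \<le> k q"
    using chain_rank[OF _ C(1-3)] P unfolding in_PP_def by blast
  have inj: "p = q" if "p \<in> C" "q \<in> C" "k p = k q" for p q
    using k that unfolding bij_betw_def inj_on_def by blast
  have kC: "k p < card C" if "p \<in> C" for p using k that unfolding bij_betw_def by blast
  have surj: "\<exists>p \<in> C. k p = j" if "j < card C" for j
    using k that unfolding bij_betw_def by (metis imageE lessThan_iff)
  have d: "of_bool c < \<delta> p" if "p \<in> C" for p c
  proof -
    have "\<delta> p \<noteq> 0" "\<delta> p \<noteq> 1" using P C(1) that unfolding in_PP_def by auto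
    then show ?thesis by (cases c) auto
  qed
  have card0: "card C > 0" using C by (simp add: card_gt_0_iff)
  obtain t where t: "t \<in> C" "k t = card C - 1" using surj[of "card C - 1"] card0 by auto
  define \<beta> where "\<beta> b p = (if p \<in> C then of_bool (b (k p)) else 0 :: nat)" for b p
  define bits where "bits x = (\<lambda>j. \<exists>p \<in> C. k p = j \<and> x p = (1::nat))" for x
  \<comment> \<open>Coordinates may exceed 1. The action is confined to the initial part of the
    chain on which all coordinates are bits; the action does not change where this part
    ends.\<close>
  define ok where "ok x p \<longleftrightarrow> p \<in> C \<and> (\<forall>q \<in> C. k q \<le> k p \<longrightarrow> x q \<le> (1::nat))" for x p
  define act where "act g x p = (if ok x p then of_bool (g (bits x) (k p)) else x p)"
    for g :: "(nat \<Rightarrow> bool) \<Rightarrow> (nat \<Rightarrow> bool)" and x p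
  have bits: "bits x (k p) \<longleftrightarrow> x p = 1" if "p \<in> C" for x p
    unfolding bits_def using that inj by blast
  have agreeI: "agree (Suc (k p)) a b" if p: "p \<in> C"
    and e: "\<And>q. q \<in> C \<Longrightarrow> k q \<le> k p \<Longrightarrow> a (k q) = b (k q)" for p a b
    unfolding agree_def
  proof (intro allI impI)
    fix j assume j: "j < Suc (k p)"
    then have "j < card C" using kC[OF p] by simp
    then obtain q where "q \<in> C" "k q = j" using surj by blast
    then show "a j = b j" using e j by auto
  qed
  have "block P r \<delta> (card C) C t \<beta> act"
  proof
    show "finite C" "C \<subseteq> P" "t \<in> C" using C t by auto
    show "(q, t) \<in> r" if "q \<in> C" for q using le[OF that t(1)] kC[OF that] t(2) by simp
    show "\<beta> b \<in> cube \<delta> C" for b unfolding cube_def \<beta>_def using d by simp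
    show "\<beta> zero_branch p = 0" for p by (simp add: \<beta>_def)
    show "\<beta> b = \<beta> b' \<longleftrightarrow> agree (card C) b b'" for b b'
    proof
      assume e: "\<beta> b = \<beta> b'"
      show "agree (card C) b b'" unfolding agree_def
      proof (intro allI impI)
        fix j assume "j < card C"
        then obtain p where "p \<in> C" "k p = j" using surj by blast
        then show "b j = b' j" using fun_cong[OF e, of p] by (simp add: \<beta>_def of_bool_eq_iff)
      qed
    next
      assume "agree (card C) b b'"
      then show "\<beta> b = \<beta> b'" using kC by (auto simp: agree_def \<beta>_def fun_eq_iff)
    qed
  next
    fix g x assume "x \<in> cube \<delta> C"
    then show "act g x \<in> cube \<delta> C" unfolding cube_def act_def ok_def using d by simp
  next
    fix g b assume g: "nonexpansive g"
    have "agree (card C) (bits (\<beta> b)) b" unfolding agree_def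
    proof (intro allI impI)
      fix j assume "j < card C"
      then obtain p where "p \<in> C" "k p = j" using surj by blast
      then show "bits (\<beta> b) j = b j" using bits[of p] by (auto simp: \<beta>_def)
    qed
    then have "agree (card C) (g (bits (\<beta> b))) (g b)" by (rule nonexpansiveD[OF g])
    then have "act g (\<beta> b) p = \<beta> (g b) p" for p
      using kC[of p] by (auto simp: act_def ok_def \<beta>_def agree_def)
    then show "act g (\<beta> b) = \<beta> (g b)" by blast
  next
    fix g F and x y :: "'a \<Rightarrow> nat" and p
    assume g: "nonexpansive g" and F: "downward_closed P r F" and e: "\<And>q. q \<in> F \<Longrightarrow> x q = y q"
      and p: "p \<in> F"
    show "act g x p = act g y p"
    proof (cases "p \<in> C")
      case False
      then show ?thesis using e[OF p] by (simp add: act_def ok_def)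
    next
      case True
      have eq: "x q = y q" if "q \<in> C" "k q \<le> k p" for q
      proof (rule e)
        show "q \<in> F" using F p le[OF that(1) True] that C(1) unfolding downward_closed_def by blast
      qed
      have "agree (Suc (k p)) (bits x) (bits y)"
        by (rule agreeI[OF True]) (simp add: bits eq)
      then have "agree (Suc (k p)) (g (bits x)) (g (bits y))" by (rule nonexpansiveD[OF g])
      moreover have "ok x p \<longleftrightarrow> ok y p" unfolding ok_def using eq by simp
      ultimately show ?thesis using e[OF p] by (simp add: act_def agree_def)
    qed
  next
    fix g g' x assume g: "nonexpansive g" "nonexpansive g'" and inv: "\<And>b. g' (g b) = b"
    show "act g' (act g x) = x"
    proof
      fix p
      have down: "ok x q" if "ok x p" "q \<in> C" "k q \<le> k p" for q
        using that unfolding ok_def by (meson le_trans)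
      show "act g' (act g x) p = x p"
      proof (cases "ok x p")
        case True
        then have p: "p \<in> C" unfolding ok_def by blast
        have y: "act g x q = of_bool (g (bits x) (k q))" if "q \<in> C" "k q \<le> k p" for q
          using down[OF True that] by (simp add: act_def)
        have ok': "ok (act g x) p" unfolding ok_def using p by (auto simp: y)
        have "agree (Suc (k p)) (bits (act g x)) (g (bits x))"
          by (rule agreeI[OF p]) (simp add: bits y)
        then have "agree (Suc (k p)) (g' (bits (act g x))) (bits x)"
          using nonexpansiveD[OF g(2)] inv by metis
        then have "g' (bits (act g x)) (k p) \<longleftrightarrow> x p = 1" using bits[OF p] by (simp add: agree_Suc)
        moreover have "x p \<le> 1" using True p unfolding ok_def by simp
        ultimately show ?thesis using ok' by (auto simp: act_def[of g'])
      next
        case False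
        have "\<not> ok (act g x) p"
        proof
          assume ok': "ok (act g x) p"
          then obtain q where q: "q \<in> C" "k q \<le> k p" "\<not> x q \<le> 1" using False unfolding ok_def by blast
          then have "act g x q = x q" by (auto simp: act_def ok_def)
          then show False using ok' q unfolding ok_def by auto
        qed
        then show ?thesis using False by (simp add: act_def)
      qed
    qed
  qed
  then show ?thesis by blast
qed

text \<open>A single coordinate stores the prefix as a binary number below \<open>2 ^ n\<close>; all
  larger values are fixed by the action.\<close>

lemma singleton_block:
  assumes P: "in_PP P r \<delta>" and t: "t \<in> P" "\<delta> t \<ge> 2 ^ n"
  shows "\<exists>\<beta> act. block P r \<delta> n {t} t \<beta> act"
proof -
  define enc :: "(nat \<Rightarrow> bool) \<Rightarrow> nat" where "enc b = horner_sum of_bool 2 (map b [0..<n])" for b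
  define dec :: "nat \<Rightarrow> nat \<Rightarrow> bool" where "dec m = (\<lambda>j. j < n \<and> bit m j)" for m
  have enc_less: "enc b < 2 ^ n" for b
    unfolding enc_def using horner_sum_of_bool_2_less[of "map b [0..<n]"]
    by (metis diff_zero length_map length_upt)
  have bit_enc: "bit (enc b) j \<longleftrightarrow> j < n \<and> b j" for b j
    unfolding enc_def by (auto simp: bit_horner_sum_bit_iff)
  have enc_eq: "enc b = enc b' \<longleftrightarrow> agree n b b'" for b b'
    by (auto simp: bit_eq_iff bit_enc agree_def)
  have dec_enc: "agree n (dec (enc b)) b" for b
    by (simp add: agree_def dec_def bit_enc)
  have enc_dec: "enc (dec m) = m" if "m < 2 ^ n" for m
  proof (rule bit_eqI)
    fix j
    have "bit m j \<Longrightarrow> j < n"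
      using that by (metis bit_take_bit_iff take_bit_nat_eq_self)
    then show "bit (enc (dec m)) j = bit m j" by (auto simp: bit_enc dec_def)
  qed
  have enc_zero: "enc zero_branch = 0"
    by (rule bit_eqI) (simp add: bit_enc)
  define \<beta> where "\<beta> b p = (if p = t then enc b else 0)" for b p
  define act where "act g x p = (if p = t \<and> x t < 2 ^ n then enc (g (dec (x t))) else x p)"
    for g :: "(nat \<Rightarrow> bool) \<Rightarrow> (nat \<Rightarrow> bool)" and x p
  have less: "enc b < \<delta> t" for b using enc_less t(2) order.strict_trans2 by blast
  have "block P r \<delta> n {t} t \<beta> act"
  proof
    show "finite {t}" "{t} \<subseteq> P" "t \<in> {t}" using t by auto
    show "(q, t) \<in> r" if "q \<in> {t}" for q
      using P that t unfolding in_PP_def partial_order_on_def preorder_on_def refl_on_def by blast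
    show "\<beta> b \<in> cube \<delta> {t}" for b unfolding cube_def \<beta>_def using less by simp
    show "\<beta> zero_branch p = 0" for p by (simp add: \<beta>_def enc_zero)
    show "\<beta> b = \<beta> b' \<longleftrightarrow> agree n b b'" for b b'
      unfolding enc_eq[symmetric] by (auto simp: \<beta>_def fun_eq_iff)
  next
    fix g x assume "x \<in> cube \<delta> {t}"
    then show "act g x \<in> cube \<delta> {t}" unfolding cube_def act_def using less by auto
  next
    fix g b assume "nonexpansive g"
    then have "enc (g (dec (enc b))) = enc (g b)" using enc_eq nonexpansiveD dec_enc by blast
    then show "act g (\<beta> b) = \<beta> (g b)" by (auto simp: act_def \<beta>_def enc_less)
  next
    fix g F and x y :: "'a \<Rightarrow> nat" and p assume e: "\<And>q. q \<in> F \<Longrightarrow> x q = y q" "p \<in> F"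
    have "x p = y p" by (rule e)+
    then show "act g x p = act g y p" by (auto simp: act_def)
  next
    fix g g' x assume g: "nonexpansive g" "nonexpansive g'" and inv: "\<And>b. g' (g b) = b"
    have "enc (g' (dec (enc (g b)))) = enc b" for b
      using enc_eq nonexpansiveD[OF g(2) dec_enc[of "g b"]] inv by metis
    then show "act g' (act g x) = x"
      by (auto simp: act_def enc_less enc_dec fun_eq_iff)
  qed
  then show ?thesis by blast
qed

section \<open>Disjoint blocks in an unbounded set\<close>

lemma unbounded_block:
  assumes P: "in_PP P r \<delta>" and Z: "Z \<subseteq> P" "\<not> bdd r \<delta> Z" and F: "finite F"
  shows "\<exists>C t \<beta> act. C \<subseteq> Z - F \<and> block P r \<delta> (Suc n) C t \<beta> act"
proof -
  \<comment> \<open>The last two summands keep the block off \<open>F\<close>: an element whose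
    \<open>\<delta>\<close> exceeds \<open>?m\<close> is not in \<open>F\<close>, and a chain with
    more than \<open>?m\<close> elements retains at least \<open>Suc n\<close> of them outside
    \<open>F\<close>.\<close>
  let ?m = "2 ^ Suc n + card F + (\<Sum>p \<in> F. \<delta> p)"
  consider q where "q \<in> Z" "\<delta> q > ?m"
    | C where "C \<subseteq> Z" "C \<in> Chains r" "\<not> (finite C \<and> card C \<le> ?m)"
    using Z(2) unfolding bdd_def by (meson not_le)
  then show ?thesis
  proof cases
    case 1
    have "q \<notin> F"
    proof
      assume "q \<in> F"
      then have "\<delta> q \<le> (\<Sum>p \<in> F. \<delta> p)" using F by (simp add: member_le_sum)
      then show False using 1(2) by simp
    qed
    then show ?thesis using singleton_block[OF P, of q "Suc n"] 1 Z(1) by (intro exI[of _ "{q}"]) auto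
  next
    case 2
    have "\<exists>D. D \<subseteq> C - F \<and> finite D \<and> card D = Suc n"
    proof (cases "finite C")
      case True
      then have "card C > ?m" using 2(3) by simp
      moreover have "card (C - F) \<ge> card C - card F" using F by (rule diff_card_le_card_Diff)
      moreover have "Suc n < 2 ^ Suc n" by (rule less_exp)
      ultimately have "Suc n \<le> card (C - F)" by linarith
      then show ?thesis using obtain_subset_with_card_n by metis
    next
      case False
      then have "infinite (C - F)" using F by simp
      then show ?thesis using infinite_arbitrarily_large by metis
    qed
    then obtain D where D: "D \<subseteq> C - F" "finite D" "card D = Suc n" by blast
    moreover have "D \<in> Chains r" using 2(2) D(1) unfolding Chains_def by blast
    moreover have "D \<subseteq> P" "D \<noteq> {}" using D Z(1) 2(1) by auto
    ultimately have "\<exists>t \<beta> act. block P r \<delta> (Suc n) D t \<beta> act" using chain_block[OF P, of D] by simp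
    then show ?thesis using D(1) 2(1) by blast
  qed
qed

lemma unbounded_blocks:
  fixes len :: "nat \<Rightarrow> nat"
  assumes P: "in_PP P r \<delta>" and Z: "Z \<subseteq> P" "\<not> bdd r \<delta> Z"
  shows "\<exists>C t \<beta> act. \<forall>j. C j \<subseteq> Z \<and> block P r \<delta> (Suc (len j)) (C j) (t j) (\<beta> j) (act j) \<and>
    (\<forall>i. i \<noteq> j \<longrightarrow> C i \<inter> C j = {})"
proof -
  have "\<exists>z. finite F \<longrightarrow> fst z \<subseteq> Z - F \<and>
      block P r \<delta> (Suc (len j)) (fst z) (fst (snd z)) (fst (snd (snd z))) (snd (snd (snd z)))" for F j
    using unbounded_block[OF P Z, of F "len j"] by (metis fst_conv snd_conv)
  then obtain z where z: "\<And>F j. finite F \<Longrightarrow> fst (z F j) \<subseteq> Z - F \<and>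
      block P r \<delta> (Suc (len j)) (fst (z F j)) (fst (snd (z F j))) (fst (snd (snd (z F j))))
        (snd (snd (snd (z F j))))" by metis
  \<comment> \<open>\<open>A j\<close> collects the blocks chosen before stage \<open>j\<close>. It
    is finite, so the next block can avoid it.\<close>
  define A where "A = rec_nat {} (\<lambda>j F. F \<union> fst (z F j))"
  have A: "A 0 = {}" "A (Suc j) = A j \<union> fst (z (A j) j)" for j by (simp_all add: A_def)
  have fin: "finite (A j)" for j
  proof (induction j)
    case (Suc j)
    then show ?case using A(2) z block.fin by (metis finite_UnI)
  qed (simp add: A(1))
  have mono: "A i \<subseteq> A j" if "i \<le> j" for i j using lift_Suc_mono_le[of A, OF _ that] A(2) by blast
  have disj: "fst (z (A i) i) \<inter> fst (z (A j) j) = {}" if "i < j" for i j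
  proof -
    have "fst (z (A i) i) \<subseteq> A j" using mono[of "Suc i" j] A(2)[of i] that by auto
    then show ?thesis using z[OF fin[of j], of j] by blast
  qed
  show ?thesis
    by (rule exI[of _ "\<lambda>j. fst (z (A j) j)"], rule exI[of _ "\<lambda>j. fst (snd (z (A j) j))"],
      rule exI[of _ "\<lambda>j. fst (snd (snd (z (A j) j)))"], rule exI[of _ "\<lambda>j. snd (snd (snd (z (A j) j)))"])
      (use z[OF fin] disj in \<open>metis (no_types, lifting) Diff_subset Int_commute linorder_neqE_nat subset_trans\<close>)
qed


section \<open>Points storing branches\<close>

text \<open>
  The block \<open>(e, i, n)\<close> lies in \<open>P - Q\<close> or in \<open>Q\<close> according to \<open>e\<close> and stores the first \<open>n + 1\<close>
  entries of the branch in slot \<open>(e, i)\<close>.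
\<close>
locale tree_coding =
  fixes P :: "'a set" and r :: "'a rel" and \<delta> :: "'a \<Rightarrow> nat" and Q :: "'a set"
    and C :: "bool \<times> nat \<times> nat \<Rightarrow> 'a set" and t :: "bool \<times> nat \<times> nat \<Rightarrow> 'a"
    and \<beta> :: "bool \<times> nat \<times> nat \<Rightarrow> (nat \<Rightarrow> bool) \<Rightarrow> 'a \<Rightarrow> nat"
    and act :: "bool \<times> nat \<times> nat \<Rightarrow> ((nat \<Rightarrow> bool) \<Rightarrow> (nat \<Rightarrow> bool)) \<Rightarrow> ('a \<Rightarrow> nat) \<Rightarrow> 'a \<Rightarrow> nat"
  assumes PP: "in_PP P r \<delta>" and Q: "downward_closed P r Q"
    and blocks: "\<And>j. block P r \<delta> (Suc (snd (snd j))) (C j) (t j) (\<beta> j) (act j)"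
    and disjoint: "\<And>i j. i \<noteq> j \<Longrightarrow> C i \<inter> C j = {}"
    and side: "\<And>j. C j \<subseteq> (if fst j then P - Q else Q)"
begin

definition X :: "('a \<Rightarrow> nat) set" where "X = cube \<delta> P"

text \<open>Outside the blocks \<open>ix p\<close> is arbitrary, hence the separate test
  \<open>p \<in> C (ix p)\<close> in what follows. \<open>spread\<close> can do without it because a
  code vanishes off its block.\<close>

definition ix :: "'a \<Rightarrow> bool \<times> nat \<times> nat" where "ix p = (SOME j. p \<in> C j)"

definition slot :: "bool \<times> nat \<times> nat \<Rightarrow> bool \<times> nat" where "slot j = (fst j, fst (snd j))"

definition res :: "bool \<times> nat \<times> nat \<Rightarrow> ('a \<Rightarrow> nat) \<Rightarrow> 'a \<Rightarrow> nat" where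
  "res j x = (\<lambda>p. if p \<in> C j then x p else 0)"

definition spread :: "(bool \<times> nat \<Rightarrow> nat \<Rightarrow> bool) \<Rightarrow> 'a \<Rightarrow> nat" where
  "spread bs p = \<beta> (ix p) (bs (slot (ix p))) p"

definition codes :: "(bool \<times> nat \<Rightarrow> nat \<Rightarrow> bool) set" where
  "codes = {bs. finite {s. bs s \<noteq> zero_branch} \<and> (\<forall>s. bs s = zero_branch \<or> (\<exists>k. bs s \<in> coloured k))}"

text \<open>A countable dense set of points: finite modifications realise any finite pattern of
  coordinates, while the stored branches remain recoverable from the untouched blocks.\<close>

definition D :: "('a \<Rightarrow> nat) set" where
  "D = {x \<in> X. \<exists>bs \<in> codes. finite {p. x p \<noteq> spread bs p}}"

definition br :: "('a \<Rightarrow> nat) \<Rightarrow> bool \<times> nat \<Rightarrow> nat \<Rightarrow> bool" where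
  "br x = (SOME bs. bs \<in> codes \<and> finite {p. x p \<noteq> spread bs p})"

lemma \<delta>_pos: "p \<in> P \<Longrightarrow> 0 < \<delta> p"
  using PP unfolding in_PP_def by auto

lemma ix: "p \<in> C j \<Longrightarrow> ix p = j"
  unfolding ix_def using disjoint by (metis (mono_tags, lifting) IntI empty_iff someI)

lemma cube_outside: "x \<in> cube \<delta> A \<Longrightarrow> p \<notin> A \<Longrightarrow> x p = 0"
  by (simp add: cube_def)

lemma res_cube: "x \<in> X \<Longrightarrow> res j x \<in> cube \<delta> (C j)"
  using block.sub[OF blocks, of j] by (auto simp: res_def X_def cube_def)

lemma res_spread: "res j (spread bs) = \<beta> j (bs (slot j))"
  using cube_outside[OF block.code_cube[OF blocks]] by (auto simp: res_def spread_def ix fun_eq_iff)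

lemma spread_outside: "p \<notin> C (ix p) \<Longrightarrow> spread bs p = 0"
  using cube_outside[OF block.code_cube[OF blocks]] by (simp add: spread_def)

lemma spread_zero: "bs (slot (ix p)) = zero_branch \<Longrightarrow> spread bs p = 0"
  using block.code_zero[OF blocks] by (simp add: spread_def)

lemma spread_X: "spread bs \<in> X"
proof -
  have "spread bs p < \<delta> p" if "p \<in> P" for p
  proof (cases "p \<in> C (ix p)")
    case True
    then show ?thesis using block.code_cube[OF blocks] by (auto simp: spread_def cube_def)
  qed (use \<delta>_pos that spread_outside in simp)
  moreover have "spread bs p = 0" if "p \<notin> P" for p
    using that block.sub[OF blocks] by (intro spread_outside) blast
  ultimately show ?thesis by (simp add: X_def cube_def)
qed

text \<open>By disjointness a wrong coordinate spoils at most one block.\<close>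

lemma finite_res:
  assumes "finite {p. x p \<noteq> spread bs p}"
  shows "finite {j. res j x \<noteq> \<beta> j (bs (slot j))}"
proof (rule finite_subset)
  show "finite (ix ` {p. x p \<noteq> spread bs p})" using assms by simp
  show "{j. res j x \<noteq> \<beta> j (bs (slot j))} \<subseteq> ix ` {p. x p \<noteq> spread bs p}"
  proof
    fix j assume "j \<in> {j. res j x \<noteq> \<beta> j (bs (slot j))}"
    then have "res j x \<noteq> res j (spread bs)" by (simp add: res_spread)
    then obtain p where "p \<in> C j" "x p \<noteq> spread bs p" unfolding res_def by metis
    then show "j \<in> ix ` {p. x p \<noteq> spread bs p}" using ix by blast
  qed
qed

lemma eventually_res:
  assumes "finite {p. x p \<noteq> spread bs p}"
  shows "\<exists>m. \<forall>n \<ge> m. res (e, i, n) x = \<beta> (e, i, n) (bs (e, i))"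
proof -
  have "finite ((snd \<circ> snd) ` {j. res j x \<noteq> \<beta> j (bs (slot j))})" (is "finite ?N")
    using finite_res[OF assms] by simp
  then obtain m where m: "\<forall>n \<in> ?N. n < m" using finite_nat_set_iff_bounded by auto
  have "res (e, i, n) x = \<beta> (e, i, n) (bs (e, i))" if "n \<ge> m" for n
  proof (rule ccontr)
    assume "res (e, i, n) x \<noteq> \<beta> (e, i, n) (bs (e, i))"
    then have "n \<in> ?N" by (intro image_eqI[of _ _ "(e, i, n)"]) (auto simp: slot_def)
    then show False using m that leD by blast
  qed
  then show ?thesis by blast
qed

lemma code_eq: "\<beta> (e, i, n) b = \<beta> (e, i, n) b' \<longleftrightarrow> agree (Suc n) b b'"
  using block.code_eq[OF blocks, of "(e, i, n)"] by simp

text \<open>All but finitely many blocks of a slot hold correct prefixes, so coincidences in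
  arbitrarily late blocks force common prefixes of arbitrary length. In particular \<open>br\<close>
  does not depend on its choice.\<close>

lemma branch_eqI:
  assumes x: "finite {p. x p \<noteq> spread bs p}" and y: "finite {p. y p \<noteq> spread bs' p}"
    and e: "\<And>m. \<exists>n \<ge> m. res (e, i, n) x = res (e, i, n) y"
  shows "bs (e, i) = bs' (e, i)"
proof (rule agree_imp_eq)
  fix m
  obtain m1 m2 where m: "\<And>n. n \<ge> m1 \<Longrightarrow> res (e, i, n) x = \<beta> (e, i, n) (bs (e, i))"
    "\<And>n. n \<ge> m2 \<Longrightarrow> res (e, i, n) y = \<beta> (e, i, n) (bs' (e, i))"
    using eventually_res[OF x] eventually_res[OF y] by blast
  obtain n where n: "n \<ge> max m (max m1 m2)" "res (e, i, n) x = res (e, i, n) y" using e by blast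
  then have "agree (Suc n) (bs (e, i)) (bs' (e, i))" using m[of n] code_eq[of e i n] by simp
  then show "\<exists>n \<ge> m. agree n (bs (e, i)) (bs' (e, i))" using n(1) by (intro exI[of _ "Suc n"]) auto
qed

lemma br_eq:
  assumes "bs \<in> codes" "finite {p. x p \<noteq> spread bs p}"
  shows "br x = bs"
proof -
  have "br x \<in> codes \<and> finite {p. x p \<noteq> spread (br x) p}"
    unfolding br_def by (rule someI[of "\<lambda>bs. bs \<in> codes \<and> finite {p. x p \<noteq> spread bs p}" bs]) (use assms in blast)
  then have "br x (e, i) = bs (e, i)" for e i
    using branch_eqI[of x "br x" x bs e i] assms(2) by blast
  then show ?thesis by (intro ext) (metis surj_pair)
qed

lemma D_X: "x \<in> D \<Longrightarrow> x \<in> X"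
  by (simp add: D_def)

lemma br_D:
  assumes "x \<in> D"
  shows "br x \<in> codes" "finite {p. x p \<noteq> spread (br x) p}"
  using assms br_eq unfolding D_def by auto

lemma D_I: "x \<in> X \<Longrightarrow> bs \<in> codes \<Longrightarrow> finite {p. x p \<noteq> spread bs p} \<Longrightarrow> x \<in> D"
  by (auto simp: D_def)

lemma br_cases: "x \<in> D \<Longrightarrow> br x s = zero_branch \<or> (\<exists>k. br x s \<in> coloured k)"
  using br_D(1) unfolding codes_def by blast

lemma modify_D:
  assumes y: "\<And>p. p \<in> F \<Longrightarrow> p \<in> P \<and> y p < \<delta> p" and F: "finite F" and bs: "bs \<in> codes"
  shows "(\<lambda>p. if p \<in> F then y p else spread bs p) \<in> D \<and>
    br (\<lambda>p. if p \<in> F then y p else spread bs p) = bs"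
proof -
  have "(\<lambda>p. if p \<in> F then y p else spread bs p) \<in> X"
    using spread_X[of bs] y by (auto simp: X_def cube_def)
  moreover have "finite {p. (if p \<in> F then y p else spread bs p) \<noteq> spread bs p}"
    by (rule finite_subset[OF _ F]) auto
  ultimately show ?thesis using bs by (auto intro: D_I br_eq)
qed

lemma countable_codes: "countable codes"
proof (rule countable_subset)
  let ?V = "\<Union>k. coloured k"
  let ?S = "{x. finite {i. x i \<noteq> zero_branch} \<and> {i. x i \<noteq> zero_branch} \<subseteq> (UNIV :: (bool \<times> nat) set) \<and>
    (\<forall>i. x i \<noteq> zero_branch \<longrightarrow> x i \<in> ?V)}"
  show "countable ?S"
    by (rule countable_finite_modifications) (auto intro: countable_coloured)
  show "codes \<subseteq> ?S" by (auto simp: codes_def)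
qed

lemma countable_D: "countable D"
proof (rule countable_subset)
  let ?S = "\<lambda>f. {x. finite {i. x i \<noteq> f i} \<and> {i. x i \<noteq> f i} \<subseteq> P \<and>
    (\<forall>i. x i \<noteq> f i \<longrightarrow> x i \<in> (UNIV :: nat set))}"
  have "countable (?S f)" for f :: "'a \<Rightarrow> nat"
    by (rule countable_finite_modifications) (use PP in \<open>auto simp: in_PP_def\<close>)
  then show "countable (\<Union>bs \<in> codes. ?S (spread bs))" using countable_codes by blast
  show "D \<subseteq> (\<Union>bs \<in> codes. ?S (spread bs))"
  proof
    fix x assume x: "x \<in> D"
    have "x p = spread (br x) p" if "p \<notin> P" for p
      using that D_X[OF x] spread_X by (simp add: X_def cube_def)
    then have "x \<in> ?S (spread (br x))" using br_D[OF x] by blast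
    then show "x \<in> (\<Union>bs \<in> codes. ?S (spread bs))" using br_D(1)[OF x] by blast
  qed
qed

section \<open>The action of isometries on points\<close>

definition gact :: "((nat \<Rightarrow> bool) \<Rightarrow> (nat \<Rightarrow> bool)) \<Rightarrow> ('a \<Rightarrow> nat) \<Rightarrow> 'a \<Rightarrow> nat" where
  "gact g x p = (if p \<in> C (ix p) then act (ix p) g (res (ix p) x) p else x p)"

lemma res_gact:
  assumes "nonexpansive g" "x \<in> X"
  shows "res j (gact g x) = act j g (res j x)"
  using cube_outside[OF block.act_cube[OF blocks assms(1) res_cube[OF assms(2)]]]
  by (auto simp: res_def[of _ "gact g x"] gact_def ix fun_eq_iff)

lemma gact_X:
  assumes "nonexpansive g" "x \<in> X"
  shows "gact g x \<in> X"
proof -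
  have "gact g x p < \<delta> p" if "p \<in> P" for p
  proof (cases "p \<in> C (ix p)")
    case True
    then show ?thesis
      using block.act_cube[OF blocks assms(1) res_cube[OF assms(2)]] by (auto simp: gact_def cube_def)
  qed (use assms that in \<open>simp add: gact_def X_def cube_def\<close>)
  moreover have "gact g x p = 0" if "p \<notin> P" for p
    using that block.sub[OF blocks, of "ix p"] assms(2) by (auto simp: gact_def X_def cube_def)
  ultimately show ?thesis by (simp add: X_def cube_def)
qed

lemma gact_agree:
  assumes g: "nonexpansive g" and F: "downward_closed P r F" and x: "x \<in> X" "y \<in> X"
    and e: "\<forall>q \<in> F. x q = y q"
  shows "\<forall>q \<in> F. gact g x q = gact g y q"
proof
  fix q assume q: "q \<in> F"
  have "act (ix q) g (res (ix q) x) q = act (ix q) g (res (ix q) y) q"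
    by (rule block.act_agree[OF blocks g F res_cube[OF x(1)] res_cube[OF x(2)] _ q])
      (use e in \<open>simp add: res_def\<close>)
  then show "gact g x q = gact g y q" using e q by (simp add: gact_def)
qed

lemma gact_inverse:
  assumes g: "nonexpansive g" "nonexpansive g'" "\<And>b. g' (g b) = b" and x: "x \<in> X"
  shows "gact g' (gact g x) = x"
proof
  fix p
  show "gact g' (gact g x) p = x p"
  proof (cases "p \<in> C (ix p)")
    case True
    then have "gact g' (gact g x) p = act (ix p) g' (act (ix p) g (res (ix p) x)) p"
      unfolding gact_def[of g'] using res_gact[OF g(1) x] by simp
    also have "\<dots> = res (ix p) x p" using block.act_inverse[OF blocks g res_cube[OF x]] by simp
    finally show ?thesis using True by (simp add: res_def)
  qed (simp add: gact_def)
qed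

text \<open>All but finitely many blocks of \<open>x\<close> are codes of its branches and are sent
  to codes of the image branches. The exceptional blocks are finite, so they contribute only a
  finite modification.\<close>

lemma gact_D:
  assumes g: "nonexpansive g" and z: "g zero_branch = zero_branch"
    and c: "\<And>b k. b \<in> coloured k \<Longrightarrow> \<exists>l. g b \<in> coloured l" and x: "x \<in> D"
  shows "gact g x \<in> D \<and> br (gact g x) = g \<circ> br x"
proof -
  note b = br_D[OF x]
  have "{s. (g \<circ> br x) s \<noteq> zero_branch} \<subseteq> {s. br x s \<noteq> zero_branch}" using z by auto
  moreover have "(g \<circ> br x) s = zero_branch \<or> (\<exists>k. (g \<circ> br x) s \<in> coloured k)" for s
    using br_cases[OF x, of s] c z by auto
  ultimately have codes: "g \<circ> br x \<in> codes"
    using b(1) finite_subset unfolding codes_def by blast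
  let ?J = "{j. res j x \<noteq> \<beta> j (br x (slot j))}"
  have "{p. gact g x p \<noteq> spread (g \<circ> br x) p} \<subseteq> (\<Union>j \<in> ?J. C j) \<union> {p. x p \<noteq> spread (br x) p}"
  proof
    fix p assume p: "p \<in> {p. gact g x p \<noteq> spread (g \<circ> br x) p}"
    show "p \<in> (\<Union>j \<in> ?J. C j) \<union> {p. x p \<noteq> spread (br x) p}"
    proof (cases "p \<in> C (ix p)")
      case True
      have "ix p \<in> ?J"
      proof (rule ccontr)
        assume "ix p \<notin> ?J"
        then have "act (ix p) g (res (ix p) x) = \<beta> (ix p) (g (br x (slot (ix p))))"
          using block.act_code[OF blocks g] by simp
        then show False using p True by (simp add: gact_def spread_def)
      qed
      then show ?thesis using True by blast
    next
      case False
      then show ?thesis using p spread_outside by (simp add: gact_def)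
    qed
  qed
  moreover have "finite ((\<Union>j \<in> ?J. C j) \<union> {p. x p \<noteq> spread (br x) p})"
    using finite_res[OF b(2)] b(2) block.fin[OF blocks] by simp
  ultimately have fin: "finite {p. gact g x p \<noteq> spread (g \<circ> br x) p}" by (rule finite_subset)
  then show ?thesis
    using D_I[OF gact_X[OF g D_X[OF x]] codes] br_eq[OF codes] by blast
qed

text \<open>The zero point codes zero branches everywhere and is therefore fixed; comparing
  \<open>x\<close> with it under \<open>g\<close> and its image under \<open>g'\<close> gives the
  two directions.\<close>

lemma gact_zero_iff:
  assumes g: "nonexpansive g" "nonexpansive g'" "\<And>b. g' (g b) = b"
    and z: "g zero_branch = zero_branch" "g' zero_branch = zero_branch"
    and F: "downward_closed P r F" and x: "x \<in> X"
  shows "(\<forall>q \<in> F. gact g x q = 0) \<longleftrightarrow> (\<forall>q \<in> F. x q = 0)"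
proof -
  have 0: "(\<lambda>_. 0) \<in> X" using \<delta>_pos by (simp add: X_def cube_def)
  have g0: "gact f (\<lambda>_. 0) = (\<lambda>_. 0)" if "nonexpansive f" "f zero_branch = zero_branch" for f
  proof -
    have "res j (\<lambda>_. 0) = \<beta> j zero_branch" for j
      using block.code_zero[OF blocks] by (simp add: res_def fun_eq_iff)
    then have "act j f (res j (\<lambda>_. 0)) p = 0" for j p
      using block.act_code[OF blocks that(1)] block.code_zero[OF blocks] that(2) by simp
    then show ?thesis by (simp add: gact_def fun_eq_iff)
  qed
  show ?thesis
    using gact_agree[OF g(1) F x 0] gact_agree[OF g(2) F gact_X[OF g(1) x] 0]
      gact_inverse[OF g x] g0[OF g(1) z(1)] g0[OF g(2) z(2)] by auto
qed

end


section \<open>Multiplicities and their isomorphisms\<close>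

text \<open>The equality type of a list. Recording it in multiplicities makes isomorphisms preserve
  the length of a list of colours and the coincidences in it.\<close>

definition pattern :: "nat list \<Rightarrow> bool list list" where
  "pattern ns = map (\<lambda>i. map (\<lambda>j. ns ! i = ns ! j) [0..<length ns]) [0..<length ns]"

lemma pattern_map: "inj h \<Longrightarrow> pattern (map h ns) = pattern ns"
  by (auto simp: pattern_def inj_eq)

lemma pattern_eqD:
  assumes "pattern ns = pattern ms"
  shows "length ns = length ms"
    "i < length ns \<Longrightarrow> j < length ns \<Longrightarrow> ns ! i = ns ! j \<longleftrightarrow> ms ! i = ms ! j"
proof -
  show l: "length ns = length ms" using arg_cong[OF assms, of length] by (simp add: pattern_def)
  assume ij: "i < length ns" "j < length ns"
  have "pattern ns ! i ! j = pattern ms ! i ! j" using assms by simp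
  then show "ns ! i = ns ! j \<longleftrightarrow> ms ! i = ms ! j" using ij l by (simp add: pattern_def)
qed

context tree_coding
begin

definition listed :: "('a \<Rightarrow> nat) \<Rightarrow> nat list \<Rightarrow> bool" where
  "listed x ns \<longleftrightarrow> (\<forall>p \<in> Q. x p = 0) \<and>
     (\<forall>i. if i < length ns then br x (True, i) \<in> coloured (ns ! i) else br x (True, i) = zero_branch)"

text \<open>\<open>K\<close> codes a block outside \<open>Q\<close>, and slot \<open>K\<close> on
  \<open>Q\<close> carries the branch against which this block is tested. Zeros are demanded only on
  the part of \<open>Q\<close> below the top of the block, so a marker can agree there with a listed
  point and still be nonzero elsewhere on \<open>Q\<close>.\<close>

definition marks :: "('a \<Rightarrow> nat) \<Rightarrow> nat \<Rightarrow> bool" where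
  "marks x K \<longleftrightarrow> (\<exists>k. br x (False, K) \<in> coloured k) \<and> (\<forall>m. m \<noteq> K \<longrightarrow> br x (False, m) = zero_branch) \<and>
     (\<forall>q \<in> {q \<in> Q. (q, t (True, prod_decode K)) \<in> r}. x q = 0)"

definition hit :: "('a \<Rightarrow> nat) \<Rightarrow> nat \<Rightarrow> bool" where
  "hit x K \<longleftrightarrow> res (True, prod_decode K) x = \<beta> (True, prod_decode K) (br x (False, K))"

text \<open>
  \<open>None\<close> is an infinite multiplicity. The residues modulo 4 separate the two kinds of points, and the
  last summand is the information carried by a point of the given kind. The descriptions occur only
  under the corresponding existence conditions.
\<close>
definition mult :: "(nat list \<Rightarrow> bool) \<Rightarrow> ('a \<Rightarrow> nat) \<Rightarrow> nat option" where
  "mult S x =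
     (if \<exists>ns. listed x ns
      then Some (4 * to_nat (pattern (THE ns. listed x ns)) + 1 + of_bool (S (THE ns. listed x ns)))
      else if \<exists>K. marks x K then Some (4 * (THE K. marks x K) + 3 + of_bool (hit x (THE K. marks x K)))
      else None)"

lemma listed_unique:
  assumes "listed x ns" "listed x ms"
  shows "ns = ms"
proof -
  have z: "br x (True, i) = zero_branch \<longleftrightarrow> length l \<le> i" if "listed x l" for l i
    using that zero_not_coloured unfolding listed_def by (metis not_le)
  have "length ns = length ms"
    using z[OF assms(1)] z[OF assms(2)] by (metis le_antisym order_refl)
  then show ?thesis
    using assms coloured_unique unfolding listed_def by (intro nth_equalityI) metis+
qed

lemma marks_unique: "marks x K \<Longrightarrow> marks x K' \<Longrightarrow> K = K'"
  using zero_not_coloured unfolding marks_def by metis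

lemma zero_res: "(\<forall>p \<in> C j. x p = 0) \<Longrightarrow> res j x = \<beta> j zero_branch"
  using block.code_zero[OF blocks] by (simp add: res_def fun_eq_iff)

text \<open>A listed point vanishes on \<open>Q\<close> and so stores only zero branches there,
  whereas a marker stores a coloured one.\<close>

lemma not_listed_marks:
  assumes "x \<in> D" "listed x ns" "marks x K"
  shows False
proof -
  have "br x (False, K) = zero_branch"
  proof (rule agree_imp_eq)
    fix m
    obtain m' where m': "\<forall>n \<ge> m'. res (False, K, n) x = \<beta> (False, K, n) (br x (False, K))"
      using eventually_res[OF br_D(2)[OF assms(1)]] by blast
    let ?n = "max m m'"
    have "res (False, K, ?n) x = \<beta> (False, K, ?n) zero_branch"
      using assms(2) side[of "(False, K, ?n)"] by (intro zero_res) (auto simp: listed_def)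
    then have "agree (Suc ?n) (br x (False, K)) zero_branch" using m' code_eq by simp
    then show "\<exists>n \<ge> m. agree n (br x (False, K)) zero_branch" by (intro exI[of _ "Suc ?n"]) simp
  qed
  then show False using assms(3) zero_not_coloured unfolding marks_def by metis
qed

lemma mult_listed:
  assumes "listed x ns"
  shows "mult S x = Some (4 * to_nat (pattern ns) + 1 + of_bool (S ns))"
proof -
  have "(THE ns. listed x ns) = ns" using assms listed_unique by blast
  then show ?thesis using assms by (auto simp: mult_def)
qed

lemma mult_marks:
  assumes "x \<in> D" "marks x K"
  shows "mult S x = Some (4 * K + 3 + of_bool (hit x K))"
proof -
  have "(THE K. marks x K) = K" using assms marks_unique by blast
  then show ?thesis using assms not_listed_marks by (auto simp: mult_def)
qed

lemma mult_Some:
  assumes "x \<in> D" "mult S x = Some v"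
  obtains ns where "listed x ns" "v = 4 * to_nat (pattern ns) + 1 + of_bool (S ns)"
  | K where "marks x K" "v = 4 * K + 3 + of_bool (hit x K)"
proof -
  have "(\<exists>ns. listed x ns) \<or> (\<exists>K. marks x K)" using assms(2) by (auto simp: mult_def split: if_splits)
  then show ?thesis using that mult_listed mult_marks[OF assms(1)] assms(2) by (metis option.inject)
qed

lemma mult_eq_listed:
  assumes "y \<in> D" "listed x ns" "mult S' y = mult S x"
  obtains ms where "listed y ms" "pattern ms = pattern ns" "S' ms = S ns"
proof -
  let ?v = "4 * to_nat (pattern ns) + 1 + of_bool (S ns)"
  have "mult S' y = Some ?v" using mult_listed[OF assms(2)] assms(3) by simp
  then show ?thesis
  proof (rule mult_Some[OF assms(1)])
    fix ms assume ms: "listed y ms" "?v = 4 * to_nat (pattern ms) + 1 + of_bool (S' ms)"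
    have "to_nat (pattern ns) = to_nat (pattern ms) \<and> S ns = S' ms"
      using ms(2) by (cases "S ns"; cases "S' ms") (simp_all, presburger+)
    then show ?thesis using that ms(1) by simp
  next
    fix K assume "?v = 4 * K + 3 + of_bool (hit y K)"
    then have False by (cases "S ns"; cases "hit y K") (simp_all, presburger+)
    then show ?thesis ..
  qed
qed

lemma mult_eq_marks:
  assumes "x \<in> D" "y \<in> D" "marks x K" "mult S' y = mult S x"
  shows "marks y K \<and> hit y K = hit x K"
proof -
  let ?v = "4 * K + 3 + of_bool (hit x K)"
  have "mult S' y = Some ?v" using mult_marks[OF assms(1,3)] assms(4) by simp
  then show ?thesis
  proof (rule mult_Some[OF assms(2)])
    fix ms assume ms: "?v = 4 * to_nat (pattern ms) + 1 + of_bool (S' ms)"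
    then have False by (cases "S' ms"; cases "hit x K") (simp_all, presburger+)
    then show ?thesis ..
  next
    fix K' assume K': "marks y K'" "?v = 4 * K' + 3 + of_bool (hit y K')"
    then have "K = K' \<and> hit x K = hit y K'"
      by (cases "hit x K"; cases "hit y K'") (simp_all, presburger+)
    then show ?thesis using K'(1) by blast
  qed
qed

definition below :: "'a \<Rightarrow> 'a set" where "below p = {q \<in> P. (q, p) \<in> r}"

text \<open>Agreement on \<open>below p\<close> will be the relation \<open>E_p\<close> of the
  model, so these maps are the isomorphisms between two weightings of the point set
  \<open>D\<close>.\<close>

definition D_iso :: "(nat list \<Rightarrow> bool) \<Rightarrow> (nat list \<Rightarrow> bool) \<Rightarrow> (('a \<Rightarrow> nat) \<Rightarrow> 'a \<Rightarrow> nat) \<Rightarrow> bool" where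
  "D_iso S S' G \<longleftrightarrow> bij_betw G D D \<and>
     (\<forall>p \<in> P. \<forall>x \<in> D. \<forall>y \<in> D. (\<forall>q \<in> below p. x q = y q) \<longleftrightarrow> (\<forall>q \<in> below p. G x q = G y q)) \<and>
     (\<forall>x \<in> D. mult S' (G x) = mult S x)"

lemma partial_order: "partial_order_on P r"
  using PP by (simp add: in_PP_def)

lemma r_refl: "p \<in> P \<Longrightarrow> (p, p) \<in> r"
  using partial_order unfolding partial_order_on_def preorder_on_def refl_on_def by blast

lemma r_trans: "(a, b) \<in> r \<Longrightarrow> (b, c) \<in> r \<Longrightarrow> (a, c) \<in> r"
  using partial_order unfolding partial_order_on_def preorder_on_def trans_def by blast

lemma below_down: "downward_closed P r (below p)"
  unfolding downward_closed_def below_def using r_trans by blast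

lemma finite_below: "p \<in> P \<Longrightarrow> finite (below p)"
  using PP unfolding in_PP_def below_def by blast

lemma gact_listed:
  assumes g: "nonexpansive g" "nonexpansive g'" "\<And>b. g' (g b) = b"
    and z: "g zero_branch = zero_branch" "g' zero_branch = zero_branch"
    and c: "\<And>b k. b \<in> coloured k \<Longrightarrow> g b \<in> coloured (h k)"
    and x: "x \<in> D" "listed x ns"
  shows "listed (gact g x) (map h ns)"
proof -
  have "br (gact g x) = g \<circ> br x" using gact_D[OF g(1) z(1) _ x(1)] c by blast
  then show ?thesis
    using x gact_zero_iff[OF g z Q D_X[OF x(1)]] c z(1) unfolding listed_def by auto
qed

text \<open>Being hit is an equation between a block and the code of a branch. The action commutes
  with coding and is injective on the block, so the equation is preserved in both
  directions.\<close>

lemma gact_marks: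
  assumes g: "nonexpansive g" "nonexpansive g'" "\<And>b. g' (g b) = b"
    and z: "g zero_branch = zero_branch" "g' zero_branch = zero_branch"
    and c: "\<And>b k. b \<in> coloured k \<Longrightarrow> g b \<in> coloured (h k)"
    and x: "x \<in> D" "marks x K"
  shows "marks (gact g x) K \<and> hit (gact g x) K = hit x K"
proof -
  let ?j = "(True, prod_decode K)"
  have "downward_closed P r {q \<in> Q. (q, t ?j) \<in> r}"
    using Q r_trans unfolding downward_closed_def by blast
  note zero = gact_zero_iff[OF g z this D_X[OF x(1)]]
  have br: "br (gact g x) = g \<circ> br x" using gact_D[OF g(1) z(1) _ x(1)] c by blast
  have marks: "marks (gact g x) K" using x(2) zero br c z(1) unfolding marks_def by auto
  let ?b = "br x (False, K)"
  have act: "act ?j g (\<beta> ?j b) = \<beta> ?j (g b)" "act ?j g' (\<beta> ?j b) = \<beta> ?j (g' b)" for b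
    using block.act_code[OF blocks] g by auto
  have "act ?j g (res ?j x) = \<beta> ?j (g ?b) \<longleftrightarrow> res ?j x = \<beta> ?j ?b"
    using block.act_inverse[OF blocks g res_cube[OF D_X[OF x(1)]], of ?j] act g(3) by metis
  then have "hit (gact g x) K = hit x K"
    unfolding hit_def res_gact[OF g(1) D_X[OF x(1)]] br by simp
  then show ?thesis using marks by blast
qed

lemma D_iso_of_bij:
  assumes h: "bij h" and S: "\<And>ns. S' (map h ns) = S ns"
  shows "\<exists>G. D_iso S S' G"
proof -
  obtain g g' where g: "nonexpansive g" "nonexpansive g'" "\<And>b. g (g' b) = b" "\<And>b. g' (g b) = b"
    "g zero_branch = zero_branch" "g' zero_branch = zero_branch"
    "\<And>k b. b \<in> coloured k \<Longrightarrow> g b \<in> coloured (h k)" "\<And>k b. b \<in> coloured (h k) \<Longrightarrow> g' b \<in> coloured k"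
    using colour_permutation_isometry[OF h] by blast
  have inv: "h (inv h k) = k" "inv h (h k) = k" for k using h by (simp_all add: bij_is_inj bij_is_surj surj_f_inv_f)
  have g'c: "g' b \<in> coloured (inv h k)" if "b \<in> coloured k" for b k
    using g(8)[of b "inv h k"] that inv by simp
  have D: "gact g x \<in> D" "gact g' x \<in> D" if "x \<in> D" for x
    using gact_D[OF g(1,5) _ that] gact_D[OF g(2,6) _ that] g(7) g'c by blast+
  have gg: "gact g' (gact g x) = x" "gact g (gact g' x) = x" if "x \<in> D" for x
    using gact_inverse[OF g(1,2,4) D_X[OF that]] gact_inverse[OF g(2,1,3) D_X[OF that]] .
  have bij: "bij_betw (gact g) D D"
    by (rule bij_betw_byWitness[of _ "gact g'"]) (use D gg in auto)
  have "(\<forall>q \<in> below p. x q = y q) \<longleftrightarrow> (\<forall>q \<in> below p. gact g x q = gact g y q)"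
    if "x \<in> D" "y \<in> D" for p x y
    using gact_agree[OF g(1) below_down D_X[OF that(1)] D_X[OF that(2)]]
      gact_agree[OF g(2) below_down D_X[OF D(1)[OF that(1)]] D_X[OF D(1)[OF that(2)]]] gg that by metis
  moreover have "mult S' (gact g x) = mult S x" if x: "x \<in> D" for x
  proof (cases "\<exists>ns. listed x ns")
    case True
    then obtain ns where ns: "listed x ns" by blast
    show ?thesis
      using mult_listed[OF ns] mult_listed[OF gact_listed[OF g(1,2,4,5,6,7) x ns]] S
        pattern_map[OF bij_is_inj[OF h]] by simp
  next
    case nl: False
    show ?thesis
    proof (cases "\<exists>K. marks x K")
      case True
      then obtain K where K: "marks x K" by blast
      show ?thesis
        using mult_marks[OF x K] mult_marks[OF D(1)[OF x], of K] gact_marks[OF g(1,2,4,5,6,7) x K] by simp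
    next
      case False
      \<comment> \<open>If the image were of one of the two kinds, \<open>gact g'\<close> would
        carry this back to \<open>x\<close>.\<close>
      have "\<not> listed (gact g x) ns" for ns
        using gact_listed[OF g(2,1,3,6,5) g'c D(1)[OF x], where ns = ns] gg(1)[OF x] nl by auto
      moreover have "\<not> marks (gact g x) K" for K
        using gact_marks[OF g(2,1,3,6,5) g'c D(1)[OF x], where K = K] gg(1)[OF x] False by auto
      ultimately show ?thesis using nl False by (simp add: mult_def)
    qed
  qed
  ultimately show ?thesis unfolding D_iso_def using bij by blast
qed

section \<open>Recovering the permutation of colours from an isomorphism\<close>

lemma D_iso_agree:
  assumes G: "D_iso S S' G" and F: "downward_closed P r F" and x: "x \<in> D" "y \<in> D"
    and e: "\<forall>q \<in> F. x q = y q"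
  shows "\<forall>q \<in> F. G x q = G y q"
proof
  fix p assume p: "p \<in> F"
  then have pP: "p \<in> P" and sub: "below p \<subseteq> F" using F by (auto simp: downward_closed_def below_def)
  then have "\<forall>q \<in> below p. x q = y q" using e by blast
  then have "\<forall>q \<in> below p. G x q = G y q" using G pP x unfolding D_iso_def by blast
  then show "G x p = G y p" using pP r_refl by (simp add: below_def)
qed

lemma ex_listed:
  assumes "\<And>i. i < length ns \<Longrightarrow> b i \<in> coloured (ns ! i)"
  shows "\<exists>x. x \<in> D \<and> listed x ns \<and> (\<forall>i < length ns. br x (True, i) = b i)"
proof -
  define bs where "bs s = (if fst s \<and> snd s < length ns then b (snd s) else zero_branch)" for s
  have "{s. bs s \<noteq> zero_branch} \<subseteq> UNIV \<times> {..<length ns}" by (auto simp: bs_def)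
  then have "finite {s. bs s \<noteq> zero_branch}" by (rule finite_subset) simp
  then have codes: "bs \<in> codes" unfolding codes_def using assms by (auto simp: bs_def)
  have x: "spread bs \<in> D" "br (spread bs) = bs"
    using D_I[OF spread_X codes] br_eq[OF codes] by simp_all
  have "spread bs p = 0" if p: "p \<in> Q" for p
  proof (cases "p \<in> C (ix p)")
    case True
    then have "\<not> fst (ix p)" using side[of "ix p"] p by auto
    then show ?thesis by (intro spread_zero) (simp add: bs_def slot_def)
  qed (rule spread_outside)
  then have "listed (spread bs) ns" using assms unfolding listed_def x(2) by (auto simp: bs_def)
  then show ?thesis using x by (intro exI[of _ "spread bs"]) (simp add: bs_def)
qed

text \<open>An isomorphism might a priori mix the branches stored in different slots. Markers
  exclude this: what happens in slot \<open>i\<close> depends only on the branch stored there,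
  whatever the two points hold in the other slots.\<close>

lemma D_iso_slot:
  assumes G: "D_iso S S' G" and x: "x \<in> D" "listed x ns" and y: "y \<in> D" "listed y ms"
    and i: "i < length ns" and e: "br x (True, i) = br y (True, i)"
  shows "br (G x) (True, i) = br (G y) (True, i)"
proof (rule branch_eqI[of "G x" "br (G x)" "G y" "br (G y)"])
  have GD: "G z \<in> D" if "z \<in> D" for z using G that unfolding D_iso_def bij_betw_def by blast
  have Gm: "mult S' (G z) = mult S z" if "z \<in> D" for z using G that unfolding D_iso_def by blast
  show "finite {p. G x p \<noteq> spread (br (G x)) p}" "finite {p. G y p \<noteq> spread (br (G y)) p}"
    using br_D(2) GD x y by auto
  let ?b = "br x (True, i)"
  fix m
  obtain m1 m2 where m12: "\<And>n. n \<ge> m1 \<Longrightarrow> res (True, i, n) x = \<beta> (True, i, n) ?b"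
    "\<And>n. n \<ge> m2 \<Longrightarrow> res (True, i, n) y = \<beta> (True, i, n) ?b"
    using eventually_res[OF br_D(2)[OF x(1)]] eventually_res[OF br_D(2)[OF y(1)]] e by metis
  \<comment> \<open>From here on block \<open>n\<close> of the slot holds the same prefix of
    \<open>?b\<close> in both points.\<close>
  define n where "n = max m (max m1 m2)"
  define j where "j = (True, i, n)"
  define K where "K = prod_encode (i, n)"
  define p where "p = t j"
  have jK: "(True, prod_decode K) = j" by (simp add: j_def K_def)
  have Cj: "C j \<subseteq> below p"
    using block.top(2)[OF blocks, of _ j] block.sub[OF blocks, of j] unfolding below_def p_def by blast
  have pP: "p \<in> P" using block.top(1)[OF blocks] block.sub[OF blocks, of j] unfolding p_def by blast
  define bs where "bs s = (if s = (False, K) then ?b else zero_branch)" for s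
  have bcol: "?b \<in> coloured (ns ! i)" using x(2) i unfolding listed_def by metis
  then have codes: "bs \<in> codes" by (auto simp: codes_def bs_def)
  let ?z = "\<lambda>x. (\<lambda>q. if q \<in> below p then x q else spread bs q)"
  \<comment> \<open>\<open>?z w\<close> is a marker that agrees with \<open>w\<close> below the top of block \<open>j\<close>. The markers of \<open>x\<close> and \<open>y\<close>
     agree on \<open>Q\<close>, so their images carry the same marking branch, and both are hits.\<close>
  have z: "?z w \<in> D" "marks (?z w) K" "hit (?z w) K"
    if w: "w \<in> D" "\<forall>q \<in> Q. w q = 0" "res j w = \<beta> j ?b" for w
  proof -
    have "?z w \<in> D \<and> br (?z w) = bs"
    proof (rule modify_D[OF _ finite_below[OF pP] codes])
      show "q \<in> P \<and> w q < \<delta> q" if "q \<in> below p" for q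
        using that D_X[OF w(1)] by (auto simp: below_def X_def cube_def)
    qed
    then have br: "br (?z w) = bs" and "?z w \<in> D" by auto
    then show "?z w \<in> D" by blast
    show "marks (?z w) K"
      using bcol w(2) Q unfolding marks_def br jK
      by (auto simp: bs_def p_def[symmetric] below_def downward_closed_def)
    have "res j (?z w) = res j w" using Cj by (intro ext) (auto simp: res_def)
    then show "hit (?z w) K" unfolding hit_def br jK using w(3) by (simp add: bs_def)
  qed
  have zx: "\<forall>q \<in> Q. x q = 0" "res j x = \<beta> j ?b" and zy: "\<forall>q \<in> Q. y q = 0" "res j y = \<beta> j ?b"
    using x(2) y(2) m12[of n] unfolding listed_def j_def n_def by auto
  note z1 = z[OF x(1) zx] and z2 = z[OF y(1) zy]
  \<comment> \<open>The image of the marker still marks \<open>K\<close> and is still a hit, and on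
    block \<open>j\<close> it agrees with \<open>G w\<close>. So block \<open>j\<close> of
    \<open>G w\<close> is read off the branch that the image of the marker stores on
    \<open>Q\<close>.\<close>
  have im: "res j (G w) = \<beta> j (br (G (?z w)) (False, K))"
    if w: "w \<in> D" "?z w \<in> D" "marks (?z w) K" "hit (?z w) K" for w
  proof -
    have "marks (G (?z w)) K \<and> hit (G (?z w)) K"
      using mult_eq_marks[OF w(2) GD[OF w(2)] w(3) Gm[OF w(2)]] w(4) by blast
    then have "res j (G (?z w)) = \<beta> j (br (G (?z w)) (False, K))" unfolding hit_def jK by blast
    moreover have "\<forall>q \<in> below p. G (?z w) q = G w q"
      by (rule D_iso_agree[OF G below_down w(2,1)]) simp
    then have "res j (G (?z w)) = res j (G w)" using Cj by (intro ext) (auto simp: res_def)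
    ultimately show ?thesis by simp
  qed
  have "\<forall>q \<in> Q. G (?z x) q = G (?z y) q"
    by (rule D_iso_agree[OF G Q z1(1) z2(1)]) (use zx zy in simp)
  then have resQ: "res (False, s) (G (?z x)) = res (False, s) (G (?z y))" for s
    using side[of "(False, s)"] by (intro ext) (auto simp: res_def)
  have "br (G (?z x)) (False, K) = br (G (?z y)) (False, K)"
    by (rule branch_eqI[OF br_D(2)[OF GD[OF z1(1)]] br_D(2)[OF GD[OF z2(1)]]])
      (use resQ in blast)
  then have "res j (G x) = res j (G y)" using im[OF x(1) z1] im[OF y(1) z2] by simp
  then show "\<exists>n \<ge> m. res (True, i, n) (G x) = res (True, i, n) (G y)"
    by (intro exI[of _ n]) (simp add: j_def n_def)
qed

text \<open>By \<open>D_iso_slot\<close> the image colour in a slot is a function of the slot and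
  the branch there. Patterns force branches of one colour in two different slots to have images of
  one colour, which removes the dependence on slot and branch and leaves a map of colours.\<close>

lemma bij_of_D_iso:
  assumes G: "D_iso S S' G"
  shows "\<exists>h. bij h \<and> (\<forall>ns. S' (map h ns) = S ns)"
proof -
  have GD: "G x \<in> D" if "x \<in> D" for x using G that unfolding D_iso_def bij_betw_def by blast
  have im: "\<exists>ms. listed (G x) ms \<and> pattern ms = pattern ns \<and> S' ms = S ns"
    if "x \<in> D" "listed x ns" for x ns
  proof -
    have "mult S' (G x) = mult S x" using G that(1) unfolding D_iso_def by blast
    then show ?thesis using mult_eq_listed[OF GD[OF that(1)] that(2)] by blast
  qed
  define image_colour where "image_colour i b l \<longleftrightarrow> (\<exists>x ns ms. x \<in> D \<and> listed x ns \<and> listed (G x) ms \<and>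
    i < length ns \<and> length ms = length ns \<and> br x (True, i) = b \<and> ms ! i = l)" for i b l
  have unique: "l = l'" if l: "image_colour i b l" "image_colour i b l'" for i b l l'
  proof -
    obtain x ns ms where x: "x \<in> D" "listed x ns" "listed (G x) ms" "i < length ns"
      "length ms = length ns" "br x (True, i) = b" "ms ! i = l"
      using l(1) unfolding image_colour_def by blast
    obtain y ns' ms' where y: "y \<in> D" "listed y ns'" "listed (G y) ms'" "i < length ns'"
      "length ms' = length ns'" "br y (True, i) = b" "ms' ! i = l'"
      using l(2) unfolding image_colour_def by blast
    have e: "br (G x) (True, i) = br (G y) (True, i)"
      using D_iso_slot[OF G x(1,2) y(1,2) x(4)] x(6) y(6) by simp
    have "br (G x) (True, i) \<in> coloured l" "br (G y) (True, i) \<in> coloured l'"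
      using x(3,4,5,7) y(3,4,5,7) unfolding listed_def by metis+
    then show ?thesis using e coloured_unique by metis
  qed
  have two: "\<exists>l. image_colour i b l \<and> image_colour j b' l"
    if ij: "i \<noteq> j" and b: "b \<in> coloured k" "b' \<in> coloured k" for i j b b' k
  proof -
    obtain c where c: "c \<in> coloured k" using coloured_dense by blast
    \<comment> \<open>A constant list just long enough to reach both slots: its pattern says that
      all entries coincide, while the slots may hold different branches of colour
      \<open>k\<close>.\<close>
    let ?ns = "replicate (Suc (max i j)) k"
    let ?c = "\<lambda>m. if m = i then b else if m = j then b' else c"
    have cs: "?c m \<in> coloured (?ns ! m)" if "m < length ?ns" for m
      using that b c nth_replicate[of m "Suc (max i j)" k] by (simp del: replicate_Suc)
    obtain x where x: "x \<in> D" "listed x ?ns" "\<forall>m < length ?ns. br x (True, m) = ?c m"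
      using ex_listed[of ?ns ?c, OF cs] by blast
    obtain ms where ms: "listed (G x) ms" "pattern ms = pattern ?ns" using im[OF x(1,2)] by blast
    have l: "i < length ?ns" "j < length ?ns" by simp_all
    have len: "length ms = length ?ns" using pattern_eqD(1)[OF ms(2)] .
    have "?ns ! i = ?ns ! j" using l by (simp del: replicate_Suc)
    then have "ms ! i = ms ! j" using pattern_eqD(2)[OF ms(2), of i j] l len by simp
    moreover have "image_colour i b (ms ! i)" "image_colour j b' (ms ! j)"
      unfolding image_colour_def
      by (rule exI[of _ x], rule exI[of _ ?ns], rule exI[of _ ms],
        use x ms(1) l len ij in \<open>simp del: replicate_Suc\<close>)+
    ultimately show ?thesis by metis
  qed
  define base where "base k = (SOME b. b \<in> coloured k)" for k
  have base: "base k \<in> coloured k" for k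
    unfolding base_def using coloured_dense[of k] by (metis someI_ex)
  define h where "h k = (SOME l. image_colour 0 (base k) l)" for k
  have h0: "image_colour 0 (base k) (h k)" for k
    unfolding h_def by (rule someI_ex) (use two[of 0 1, OF _ base base] in auto)
  have h: "l = h k" if l: "image_colour i b l" and b: "b \<in> coloured k" for i b l k
  proof -
    \<comment> \<open>\<open>two\<close> compares distinct slots only, so slot \<open>i\<close> is
      compared with slot 0 through \<open>Suc i\<close>, which differs from both.\<close>
    obtain l1 where l1: "image_colour (Suc i) b l1" "image_colour i b l1"
      using two[of "Suc i" i, OF _ b b] by auto
    obtain l2 where l2: "image_colour (Suc i) b l2" "image_colour 0 (base k) l2"
      using two[of "Suc i" 0, OF _ b base] by auto
    show ?thesis
      using unique[OF l l1(2)] unique[OF l1(1) l2(1)] unique[OF l2(2) h0] by simp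
  qed
  have main: "listed (G x) (map h ns) \<and> pattern (map h ns) = pattern ns \<and> S' (map h ns) = S ns"
    if x: "x \<in> D" "listed x ns" for x ns
  proof -
    obtain ms where ms: "listed (G x) ms" "pattern ms = pattern ns" "S' ms = S ns"
      using im[OF x] by blast
    have len: "length ms = length ns" using pattern_eqD(1)[OF ms(2)] .
    have "ms = map h ns"
    proof (rule nth_equalityI)
      fix i assume i: "i < length ms"
      have "image_colour i (br x (True, i)) (ms ! i)"
        unfolding image_colour_def
        by (rule exI[of _ x], rule exI[of _ ns], rule exI[of _ ms]) (use x ms(1) i len in simp)
      moreover have "br x (True, i) \<in> coloured (ns ! i)" using x(2) i len unfolding listed_def by metis
      ultimately show "ms ! i = map h ns ! i" using h i len by simp
    qed (use len in simp)
    then show ?thesis using ms by blast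
  qed
  have ex: "\<exists>x. x \<in> D \<and> listed x ns" for ns
    using ex_listed[of ns "\<lambda>i. base (ns ! i)"] base by blast
  have "S' (map h ns) = S ns" and pat: "pattern (map h ns) = pattern ns" for ns
    using ex[of ns] main by blast+
  moreover have "inj h"
  proof (rule injI)
    fix k k' assume "h k = h k'"
    then show "k = k'" using pattern_eqD(2)[OF pat[of "[k, k']"], of 0 1] by simp
  qed
  moreover have "surj h"
    unfolding surj_def
  proof
    fix m
    \<comment> \<open>Multiplicities also transfer listing backwards along \<open>G\<close>, so the
      preimage of a point listing only \<open>m\<close> lists a colour that \<open>h\<close> sends
      to \<open>m\<close>.\<close>
    obtain y where y: "y \<in> D" "listed y [m]" using ex[of "[m]"] by blast
    have "y \<in> G ` D" using G y(1) unfolding D_iso_def bij_betw_def by simp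
    then obtain x where x: "x \<in> D" "G x = y" by blast
    have "mult S x = mult S' y" using G x unfolding D_iso_def by metis
    then obtain ns where ns: "listed x ns" using mult_eq_listed[OF x(1) y(2)] by blast
    then have "map h ns = [m]" using main[OF x(1) ns] x(2) listed_unique y(2) by blast
    then show "\<exists>k. m = h k" by auto
  qed
  ultimately show ?thesis unfolding bij_def by blast
qed

end


section \<open>The model of a predicate of lists\<close>

lemma fibrewise_bijection:
  assumes f: "\<And>n. f n \<in> A" and f': "\<And>n. f' n \<in> B" and G: "bij_betw G A B"
    and fibre: "\<And>x. x \<in> A \<Longrightarrow> \<exists>\<phi>. bij_betw \<phi> {n. f n = x} {n. f' n = G x}"
  shows "\<exists>H. bij H \<and> (\<forall>n. f' (H n) = G (f n))"
proof -
  obtain \<phi> where \<phi>: "\<And>x. x \<in> A \<Longrightarrow> bij_betw (\<phi> x) {n. f n = x} {n. f' n = G x}"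
    using fibre by metis
  define H where "H n = \<phi> (f n) n" for n
  have H: "f' (H n) = G (f n)" for n
    using bij_betwE[OF \<phi>[OF f[of n]]] by (simp add: H_def)
  have "inj H"
  proof (rule injI)
    fix m n assume e: "H m = H n"
    then have "G (f m) = G (f n)" using H by metis
    then have fm: "f m = f n" using G f unfolding bij_betw_def inj_on_def by blast
    have "inj_on (\<phi> (f n)) {k. f k = f n}" using \<phi>[OF f] unfolding bij_betw_def by blast
    moreover have "\<phi> (f n) m = \<phi> (f n) n" using e fm by (simp add: H_def)
    ultimately show "m = n" using fm unfolding inj_on_def by blast
  qed
  moreover have "surj H"
    unfolding surj_def
  proof
    fix m
    have "f' m \<in> G ` A" using G f' unfolding bij_betw_def by blast
    then obtain x where x: "x \<in> A" "f' m = G x" by blast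
    have "m \<in> \<phi> x ` {n. f n = x}" using \<phi>[OF x(1)] x(2) unfolding bij_betw_def by blast
    then obtain n where "f n = x" "\<phi> x n = m" by blast
    then show "\<exists>n. m = H n" by (intro exI[of _ n]) (simp add: H_def)
  qed
  ultimately show ?thesis using H unfolding bij_def by blast
qed

lemma bij_betw_nat_sets:
  fixes A B :: "nat set"
  assumes "finite A \<longleftrightarrow> finite B" "card A = card B"
  shows "\<exists>\<phi>. bij_betw \<phi> A B"
proof (cases "finite A")
  case True
  then show ?thesis using assms finite_same_card_bij by blast
next
  case False
  then have "bij_betw (enumerate A) UNIV A" "bij_betw (enumerate B) UNIV B"
    using assms bij_enumerate by auto
  then show ?thesis using bij_betw_trans bij_betw_inv_into by blast
qed

context tree_coding
begin

definition garbage :: "'a \<Rightarrow> nat" where "garbage p = (if p = t (False, 0, 0) then 1 else 0)"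

definition en :: "nat \<Rightarrow> ('a \<Rightarrow> nat) \<times> nat" where "en = from_nat_into (D \<times> UNIV)"

text \<open>
  Every point gets infinitely many candidate elements; the superfluous ones are moved to a point of
  infinite multiplicity. So the universe does not depend on \<open>S\<close>, and the relation between two
  elements depends on only two values of \<open>S\<close>, which makes the reduction continuous.
\<close>
definition lab :: "(nat list \<Rightarrow> bool) \<Rightarrow> nat \<Rightarrow> 'a \<Rightarrow> nat" where
  "lab S n = (case mult S (fst (en n)) of
     None \<Rightarrow> fst (en n) | Some v \<Rightarrow> if snd (en n) < v then fst (en n) else garbage)"

definition struct :: "(nat list \<Rightarrow> bool) \<Rightarrow> 'a struc" where
  "struct S = (\<lambda>p xs. p \<in> P \<and> length xs = 2 \<and> (\<forall>q \<in> below p. lab S (xs ! 0) q = lab S (xs ! 1) q),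
     \<lambda>_ _. 0)"

lemma zero_codes: "(\<lambda>_. zero_branch) \<in> codes"
  by (simp add: codes_def)

lemma spread_zero_branch: "spread (\<lambda>_. zero_branch) = (\<lambda>_. 0)"
  by (simp add: spread_zero fun_eq_iff)

lemma finite_support_D:
  assumes "finite F" "\<And>p. p \<in> F \<Longrightarrow> p \<in> P \<and> y p < \<delta> p"
  shows "(\<lambda>p. if p \<in> F then y p else 0) \<in> D \<and> br (\<lambda>p. if p \<in> F then y p else 0) = (\<lambda>_. zero_branch)"
  using modify_D[of F y "\<lambda>_. zero_branch"] assms zero_codes
  by (simp add: spread_zero_branch cong: if_cong)

lemma t_Q: "t (False, 0, 0) \<in> Q" "t (False, 0, 0) \<in> P"
  using block.top(1)[OF blocks, of "(False, 0, 0)"] side[of "(False, 0, 0)"] Q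
  by (auto simp: downward_closed_def)

lemma garbage_D: "garbage \<in> D" and garbage_br: "br garbage = (\<lambda>_. zero_branch)"
proof -
  have "1 < \<delta> (t (False, 0, 0))" using PP t_Q(2) unfolding in_PP_def by force
  moreover have "garbage = (\<lambda>p. if p \<in> {t (False, 0, 0)} then 1 else 0)"
    by (simp add: garbage_def fun_eq_iff)
  ultimately show "garbage \<in> D" "br garbage = (\<lambda>_. zero_branch)"
    using finite_support_D[of "{t (False, 0, 0)}" "\<lambda>_. 1"] t_Q(2) by simp_all
qed

lemma mult_garbage: "mult S garbage = None"
proof -
  have "\<not> listed garbage ns" for ns
    using t_Q(1) by (auto simp: listed_def garbage_def)
  moreover have "\<not> marks garbage K" for K
    using zero_not_coloured by (auto simp: marks_def garbage_br)
  ultimately show ?thesis by (simp add: mult_def)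
qed

lemma mult_pos: "mult S x = Some v \<Longrightarrow> 0 < v"
  by (auto simp: mult_def split: if_splits)

lemma bij_en: "bij_betw en UNIV (D \<times> UNIV)"
proof -
  have "infinite (D \<times> (UNIV :: nat set))" using garbage_D by (auto simp: finite_cartesian_product_iff)
  then show ?thesis
    unfolding en_def using countable_D by (intro bij_betw_from_nat_into) auto
qed

lemma en_D: "fst (en n) \<in> D"
  using bij_betwE[OF bij_en] by (metis UNIV_I mem_Times_iff)

lemma lab_D: "lab S n \<in> D"
  using en_D garbage_D by (auto simp: lab_def split: option.split)

lemma fibre_image:
  "en ` {n. lab S n = x} = {w \<in> D \<times> UNIV. (case mult S (fst w) of
     None \<Rightarrow> fst w | Some v \<Rightarrow> if snd w < v then fst w else garbage) = x}"
proof -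
  have "range en = D \<times> UNIV" using bij_en unfolding bij_betw_def by blast
  then have "en ` {n. R (en n)} = {w \<in> D \<times> UNIV. R w}" for R
    using Compr_image_eq[of en UNIV R] by simp
  then show ?thesis unfolding lab_def .
qed

text \<open>A point of multiplicity \<open>v\<close> keeps its first \<open>v\<close> candidates and
  receives no others, since only \<open>garbage\<close> receives elements and its own multiplicity
  is infinite.\<close>

lemma fibre_card:
  assumes x: "x \<in> D"
  shows "mult S x = Some v \<Longrightarrow> finite {n. lab S n = x} \<and> card {n. lab S n = x} = v"
    and "mult S x = None \<Longrightarrow> infinite {n. lab S n = x}"
proof -
  have inj: "inj_on en A" for A using bij_en unfolding bij_betw_def by (blast intro: inj_on_subset)
  show "finite {n. lab S n = x} \<and> card {n. lab S n = x} = v" if v: "mult S x = Some v"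
  proof -
    have "x \<noteq> garbage" using v mult_garbage by auto
    then have "(case mult S y of None \<Rightarrow> y | Some v \<Rightarrow> if j < v then y else garbage) = x \<longleftrightarrow> y = x \<and> j < v"
      for y j using v by (cases "mult S y"; cases "y = x") auto
    then have "en ` {n. lab S n = x} = {x} \<times> {..<v}"
      unfolding fibre_image using x by (intro set_eqI) (auto simp: mem_Times_iff)
    then have "finite (en ` {n. lab S n = x})" "card (en ` {n. lab S n = x}) = v" by simp_all
    then show ?thesis using inj finite_imageD card_image by metis
  qed
  show "infinite {n. lab S n = x}" if n: "mult S x = None"
  proof
    assume "finite {n. lab S n = x}"
    moreover have "{x} \<times> UNIV \<subseteq> en ` {n. lab S n = x}"
      unfolding fibre_image using x n by auto
    ultimately have "finite ({x} \<times> (UNIV :: nat set))" using finite_surj by blast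
    then show False by (auto simp: finite_cartesian_product_iff)
  qed
qed

lemma lab_surj:
  assumes "x \<in> D"
  shows "\<exists>n. lab S n = x"
proof (rule ccontr)
  assume "\<nexists>n. lab S n = x"
  then have "{n. lab S n = x} = {}" by blast
  then show False using fibre_card[OF assms, of S] mult_pos by (cases "mult S x") fastforce+
qed

section \<open>Verification of the axioms\<close>

lemma struct_rel: "p \<in> P \<Longrightarrow> fst (struct S) p [m, n] \<longleftrightarrow> (\<forall>q \<in> below p. lab S m q = lab S n q)"
  by (simp add: struct_def)

lemma lab_less: "p \<in> P \<Longrightarrow> lab S n p < \<delta> p"
  using D_X[OF lab_D] by (simp add: X_def cube_def)

text \<open>Density of \<open>D\<close> in the product; it provides the witnesses both for the
  number of classes and for amalgamation.\<close>

lemma ex_lab: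
  assumes "finite F" "F \<subseteq> P" "\<And>p. p \<in> F \<Longrightarrow> y p < \<delta> p"
  shows "\<exists>n. \<forall>p \<in> F. lab S n p = y p"
proof -
  have "(\<lambda>p. if p \<in> F then y p else 0) \<in> D" using finite_support_D[of F y] assms by blast
  then obtain n where "lab S n = (\<lambda>p. if p \<in> F then y p else 0)" using lab_surj by blast
  then show ?thesis by (intro exI[of _ n]) simp
qed

lemma struct_Mod: "struct S \<in> Mod (lang_P P) (T_P P r \<delta>)"
  unfolding Mod_T_P[OF PP]
proof (intro conjI ballI impI allI)
  show "struct S \<in> Str (lang_P P)" by (simp add: struct_def Str_def lang_P_def)
next
  fix q assume q: "q \<in> P"
  show "equiv UNIV {(x, y). fst (struct S) q [x, y]}"
    using q by (auto simp: struct_rel equiv_def refl_on_def sym_def trans_def)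
next
  fix q q' x y assume "q \<in> P" "q' \<in> P" "(q', q) \<in> r" "fst (struct S) q [x, y]"
  then show "fst (struct S) q' [x, y]"
    using r_trans by (auto simp: struct_rel below_def)
next
  fix q m assume q: "q \<in> P"
  let ?A = "{n. \<forall>q' \<in> P. (q', q) \<in> r \<and> q' \<noteq> q \<longrightarrow> fst (struct S) q' [m, n]}"
  let ?R = "{(x, y). fst (struct S) q [x, y]}"
  have A: "n \<in> ?A \<longleftrightarrow> (\<forall>q' \<in> below q - {q}. lab S m q' = lab S n q')" for n
    using r_refl r_trans partial_order unfolding partial_order_on_def antisym_def
    by (auto simp: struct_rel below_def)
  have cls: "?R `` {n} = {k. lab S k q = lab S n q \<and> k \<in> ?A}" if "n \<in> ?A" for n
    using that q r_refl unfolding A by (auto simp: struct_rel below_def)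
  \<comment> \<open>Once the coordinates strictly below \<open>q\<close> are fixed, the classes
    modulo \<open>q\<close> are told apart by coordinate \<open>q\<close>, and each of its
    \<open>\<delta> q\<close> values occurs.\<close>
  have "bij_betw (\<lambda>i. {k. lab S k q = i \<and> k \<in> ?A}) {..<\<delta> q} (?A // ?R)"
    unfolding bij_betw_def
  proof
    have ne: "\<exists>k \<in> ?A. lab S k q = i" if i: "i < \<delta> q" for i
    proof -
      have "\<exists>n. \<forall>p \<in> below q. lab S n p = (if p = q then i else lab S m p)"
        by (rule ex_lab) (use i q finite_below lab_less in \<open>auto simp: below_def\<close>)
      then obtain n where n: "\<forall>p \<in> below q. lab S n p = (if p = q then i else lab S m p)" by blast
      then have "n \<in> ?A" unfolding A by simp
      moreover have "lab S n q = i" using n q r_refl by (simp add: below_def)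
      ultimately show ?thesis by blast
    qed
    show "inj_on (\<lambda>i. {k. lab S k q = i \<and> k \<in> ?A}) {..<\<delta> q}"
    proof (rule inj_onI)
      fix i j assume "i \<in> {..<\<delta> q}" and e: "{k. lab S k q = i \<and> k \<in> ?A} = {k. lab S k q = j \<and> k \<in> ?A}"
      then obtain k where "k \<in> ?A" "lab S k q = i" using ne by blast
      then have "k \<in> {k. lab S k q = j \<and> k \<in> ?A}" unfolding e[symmetric] by blast
      then show "i = j" using \<open>lab S k q = i\<close> by blast
    qed
    show "(\<lambda>i. {k. lab S k q = i \<and> k \<in> ?A}) ` {..<\<delta> q} = ?A // ?R"
    proof
      show "(\<lambda>i. {k. lab S k q = i \<and> k \<in> ?A}) ` {..<\<delta> q} \<subseteq> ?A // ?R"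
      proof
        fix Y assume "Y \<in> (\<lambda>i. {k. lab S k q = i \<and> k \<in> ?A}) ` {..<\<delta> q}"
        then obtain i where i: "i < \<delta> q" "Y = {k. lab S k q = i \<and> k \<in> ?A}" by blast
        then obtain k where k: "k \<in> ?A" "lab S k q = i" using ne by blast
        then have "Y = ?R `` {k}" unfolding cls[OF k(1)] i(2) by simp
        then show "Y \<in> ?A // ?R" using quotientI[OF k(1)] by blast
      qed
      show "?A // ?R \<subseteq> (\<lambda>i. {k. lab S k q = i \<and> k \<in> ?A}) ` {..<\<delta> q}"
      proof
        fix Y assume "Y \<in> ?A // ?R"
        then obtain n where n: "Y = ?R `` {n}" "n \<in> ?A" by (rule quotientE)
        have "Y = {k. lab S k q = lab S n q \<and> k \<in> ?A}" unfolding n(1) by (rule cls[OF n(2)])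
        then show "Y \<in> (\<lambda>i. {k. lab S k q = i \<and> k \<in> ?A}) ` {..<\<delta> q}"
          using lab_less[OF q] by blast
      qed
    qed
  qed
  then show "card (?A // ?R) = \<delta> q" using bij_betw_same_card by fastforce
next
  fix F a assume h: "finite F \<and> downward_closed P r F \<and>
    (\<forall>q \<in> F. \<forall>q' \<in> F. (q', q) \<in> r \<longrightarrow> fst (struct S) q' [a q', a q])"
  then have F: "finite F" "F \<subseteq> P" "downward_closed P r F" by (auto simp: downward_closed_def)
  \<comment> \<open>Coordinate \<open>p\<close> is copied from the parameter indexed by
    \<open>p\<close>; compatibility makes it equal to that coordinate of every parameter
    above.\<close>
  obtain n where n: "\<And>p. p \<in> F \<Longrightarrow> lab S n p = lab S (a p) p"
    using ex_lab[OF F(1,2), of "\<lambda>p. lab S (a p) p" S] lab_less F(2) by blast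
  show "\<exists>b. \<forall>q \<in> F. fst (struct S) q [b, a q]"
  proof (intro exI[of _ n] ballI)
    fix q assume q: "q \<in> F"
    have "lab S n p = lab S (a q) p" if p: "p \<in> below q" for p
    proof -
      have pF: "p \<in> F" using F(3) q p unfolding downward_closed_def below_def by blast
      then have "fst (struct S) p [a p, a q]" using h q p unfolding below_def by blast
      then have "lab S (a p) p = lab S (a q) p"
        using pF F(2) r_refl by (auto simp: struct_rel below_def)
      then show ?thesis using n[OF pF] by simp
    qed
    then show "fst (struct S) q [n, a q]" using q F(2) by (auto simp: struct_rel)
  qed
qed

lemma D_eqI: "x \<in> D \<Longrightarrow> y \<in> D \<Longrightarrow> (\<And>p q. p \<in> P \<Longrightarrow> q \<in> below p \<Longrightarrow> x q = y q) \<Longrightarrow> x = y"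
proof
  fix q assume x: "x \<in> D" "y \<in> D" and e: "\<And>p q. p \<in> P \<Longrightarrow> q \<in> below p \<Longrightarrow> x q = y q"
  show "x q = y q"
  proof (cases "q \<in> P")
    case True
    then show ?thesis using e[of q q] r_refl by (simp add: below_def)
  next
    case False
    then show ?thesis using D_X[OF x(1)] D_X[OF x(2)] by (simp add: X_def cube_def)
  qed
qed

lemma iso_struct:
  "iso (lang_P P) (struct S) (struct S') \<longleftrightarrow>
    (\<exists>H. bij H \<and> (\<forall>p \<in> P. \<forall>m n. (\<forall>q \<in> below p. lab S' (H m) q = lab S' (H n) q) \<longleftrightarrow>
      (\<forall>q \<in> below p. lab S m q = lab S n q)))"
proof -
  have 1: "(\<forall>xs. length xs = 2 \<longrightarrow> R xs) \<longleftrightarrow> (\<forall>m n. R [m, n])" for R :: "nat list \<Rightarrow> bool"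
  proof
    assume a: "\<forall>m n. R [m, n]"
    show "\<forall>xs. length xs = 2 \<longrightarrow> R xs"
    proof (intro allI impI)
      fix xs :: "nat list" assume "length xs = 2"
      then have "xs = [xs ! 0, xs ! 1]" by (intro nth_equalityI) (auto simp: less_2_cases_iff nth_Cons')
      then show "R xs" using a by metis
    qed
  qed simp
  show ?thesis unfolding iso_def by (simp add: lang_P_def 1 struct_rel)
qed

text \<open>Equal multiplicities let a map of \<open>D\<close> lift fibre by fibre along
  \<open>lab\<close>. Conversely, the intersection of all the relations is equality of labels, so an
  isomorphism descends to \<open>D\<close>, and the sizes of fibres return the
  multiplicities.\<close>

lemma iso_struct_iff_D_iso: "iso (lang_P P) (struct S) (struct S') \<longleftrightarrow> (\<exists>G. D_iso S S' G)"
proof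
  assume "\<exists>G. D_iso S S' G"
  then obtain G where G: "D_iso S S' G" by blast
  have "\<exists>H. bij H \<and> (\<forall>n. lab S' (H n) = G (lab S n))"
  proof (rule fibrewise_bijection[of "lab S" D "lab S'" D G])
    fix x assume x: "x \<in> D"
    have Gx: "G x \<in> D" "mult S' (G x) = mult S x" using G x unfolding D_iso_def bij_betw_def by blast+
    show "\<exists>\<phi>. bij_betw \<phi> {n. lab S n = x} {n. lab S' n = G x}"
    proof (rule bij_betw_nat_sets)
      show "finite {n. lab S n = x} \<longleftrightarrow> finite {n. lab S' n = G x}"
        "card {n. lab S n = x} = card {n. lab S' n = G x}"
        using fibre_card[OF x, of S] fibre_card[OF Gx(1), of S'] Gx(2) by (cases "mult S x"; simp)+
    qed
  qed (use G lab_D in \<open>auto simp: D_iso_def\<close>)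
  then obtain H where H: "bij H" "\<And>n. lab S' (H n) = G (lab S n)" by blast
  have "(\<forall>q \<in> below p. lab S' (H m) q = lab S' (H n) q) \<longleftrightarrow> (\<forall>q \<in> below p. lab S m q = lab S n q)"
    if "p \<in> P" for p m n
    using G that lab_D unfolding H(2) D_iso_def by blast
  then show "iso (lang_P P) (struct S) (struct S')" unfolding iso_struct using H(1) by blast
next
  assume "iso (lang_P P) (struct S) (struct S')"
  then obtain H where H: "bij H" and e: "\<And>p m n. p \<in> P \<Longrightarrow>
    (\<forall>q \<in> below p. lab S' (H m) q = lab S' (H n) q) \<longleftrightarrow> (\<forall>q \<in> below p. lab S m q = lab S n q)"
    unfolding iso_struct by blast
  have eq: "lab S m = lab S n \<longleftrightarrow> lab S' (H m) = lab S' (H n)" for m n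
  proof
    assume "lab S m = lab S n"
    then show "lab S' (H m) = lab S' (H n)"
      by (intro D_eqI[OF lab_D lab_D]) (use e in metis)
  next
    assume "lab S' (H m) = lab S' (H n)"
    then show "lab S m = lab S n"
      by (intro D_eqI[OF lab_D lab_D]) (use e in metis)
  qed
  define G where "G x = lab S' (H (SOME n. lab S n = x))" for x
  have G: "G (lab S n) = lab S' (H n)" for n
  proof -
    have "lab S (SOME k. lab S k = lab S n) = lab S n" by (rule someI) simp
    then show ?thesis unfolding G_def using eq by blast
  qed
  have D: "\<exists>n. x = lab S n" if "x \<in> D" for x using lab_surj[OF that] by metis
  have GD: "G x \<in> D" if "x \<in> D" for x using lab_D by (simp add: G_def)
  have inj: "inj_on G D"
  proof (rule inj_onI)
    fix x y assume "x \<in> D" "y \<in> D" "G x = G y"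
    then show "x = y" using D G eq by metis
  qed
  have "D \<subseteq> G ` D"
  proof
    fix y assume "y \<in> D"
    then obtain n where "lab S' n = y" using lab_surj by blast
    moreover obtain m where "n = H m" using H bij_is_surj by (metis surj_def)
    ultimately have "y = G (lab S m)" using G by simp
    then show "y \<in> G ` D" using lab_D by blast
  qed
  then have "bij_betw G D D" using inj GD unfolding bij_betw_def by blast
  moreover have "(\<forall>q \<in> below p. x q = y q) \<longleftrightarrow> (\<forall>q \<in> below p. G x q = G y q)"
    if p: "p \<in> P" and x: "x \<in> D" "y \<in> D" for p x y
  proof -
    obtain m n where "x = lab S m" "y = lab S n" using D x by blast
    then show ?thesis using e[OF p, of m n] G by simp
  qed
  moreover have "mult S' (G x) = mult S x" if x: "x \<in> D" for x
  proof -
    have "lab S' m = G x \<longleftrightarrow> m \<in> H ` {n. lab S n = x}" for m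
    proof -
      obtain n where n: "m = H n" using H bij_is_surj by (metis surj_def)
      obtain k where k: "x = lab S k" using D[OF x] by blast
      have "lab S' m = G x \<longleftrightarrow> lab S n = x" unfolding n k G using eq[of n k] by simp
      then show ?thesis using n H unfolding bij_def inj_def by blast
    qed
    then have s: "{m. lab S' m = G x} = H ` {n. lab S n = x}" by blast
    have i: "inj_on H A" for A using H unfolding bij_def by (blast intro: inj_on_subset)
    have "finite {m. lab S' m = G x} \<longleftrightarrow> finite {n. lab S n = x}"
      "card {m. lab S' m = G x} = card {n. lab S n = x}"
      unfolding s using i by (simp_all add: finite_image_iff card_image)
    then show ?thesis
      using fibre_card[OF x, of S] fibre_card[OF GD[OF x], of S']
      by (cases "mult S x"; cases "mult S' (G x)") auto
  qed
  ultimately show "\<exists>G. D_iso S S' G" unfolding D_iso_def by blast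
qed

theorem iso_struct_iff:
  "iso (lang_P P) (struct S) (struct S') \<longleftrightarrow> (\<exists>h. bij h \<and> (\<forall>ns. S' (map h ns) = S ns))"
  unfolding iso_struct_iff_D_iso using D_iso_of_bij bij_of_D_iso by blast

text \<open>The multiplicity of a point consults \<open>S\<close> at one list only, which does not
  depend on \<open>S\<close>. So \<open>S\<close> may be replaced by a constant predicate with the
  right value there.\<close>

lemma struct_rel_local:
  "\<exists>\<Phi>. \<forall>S. fst (struct S) p xs = \<Phi> (S (THE ns. listed (fst (en (xs ! 0))) ns))
      (S (THE ns. listed (fst (en (xs ! 1))) ns))"
proof -
  define m where "m x c = mult (\<lambda>_. c) x" for x and c :: bool
  have m: "mult S x = m x (S (THE ns. listed x ns))" for S x
    by (simp add: mult_def m_def)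
  show ?thesis
    unfolding struct_def lab_def m
    by (rule exI[of _ "\<lambda>c d. p \<in> P \<and> length xs = 2 \<and> (\<forall>q \<in> below p.
      (case m (fst (en (xs ! 0))) c of None \<Rightarrow> fst (en (xs ! 0))
        | Some v \<Rightarrow> if snd (en (xs ! 0)) < v then fst (en (xs ! 0)) else garbage) q =
      (case m (fst (en (xs ! 1))) d of None \<Rightarrow> fst (en (xs ! 1))
        | Some v \<Rightarrow> if snd (en (xs ! 1)) < v then fst (en (xs ! 1)) else garbage) q)"]) simp
qed

end


section \<open>Encoding countable structures\<close>

text \<open>Even indices are relation symbols, odd ones the graphs of function symbols, with the
  value at the head and the arguments in the tail.\<close>

definition atom :: "nat lang \<Rightarrow> nat struc \<Rightarrow> nat \<Rightarrow> nat list \<Rightarrow> bool" where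
  "atom L M k xs =
     (if even k then fst M (k div 2) xs
      else xs \<noteq> [] \<and> k div 2 \<in> funs L \<and> length (tl xs) = fun_ar L (k div 2) \<and>
        snd M (k div 2) (tl xs) = hd xs)"

text \<open>
  The length of the list encodes both the symbol and the number of its relevant entries, so that a
  single predicate of lists carries the whole structure.
\<close>
definition encode :: "nat lang \<Rightarrow> nat struc \<Rightarrow> nat list \<Rightarrow> bool" where
  "encode L M ns = atom L M (fst (prod_decode (length ns))) (take (snd (prod_decode (length ns))) ns)"

lemma encode_iff_atom:
  "(\<forall>ns. encode L N (map h ns) = encode L M ns) \<longleftrightarrow> (\<forall>k xs. atom L N k (map h xs) = atom L M k xs)"
proof
  assume e: "\<forall>ns. encode L N (map h ns) = encode L M ns"
  show "\<forall>k xs. atom L N k (map h xs) = atom L M k xs"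
  proof (intro allI)
    fix k and xs :: "nat list"
    \<comment> \<open>Padding reaches the length that codes \<open>k\<close> and
      \<open>length xs\<close>; this code is at least \<open>length xs\<close>, and decoding
      discards the padding.\<close>
    let ?ns = "xs @ replicate (prod_encode (k, length xs) - length xs) 0"
    have "length ?ns = prod_encode (k, length xs)" using le_prod_encode_2[of "length xs" k] by simp
    then show "atom L N k (map h xs) = atom L M k xs"
      using e[rule_format, of ?ns] by (simp add: encode_def)
  qed
qed (simp add: encode_def take_map)

lemma iso_iff_atom:
  assumes M: "M \<in> Str L" and N: "N \<in> Str L"
  shows "iso L M N \<longleftrightarrow> (\<exists>h. bij h \<and> (\<forall>k xs. atom L N k (map h xs) = atom L M k xs))"
    (is "_ \<longleftrightarrow> (\<exists>h. bij h \<and> ?atoms h)")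
proof -
  have "(\<forall>s \<in> rels L. \<forall>xs. length xs = rel_ar L s \<longrightarrow> fst N s (map h xs) = fst M s xs) \<and>
     (\<forall>s \<in> funs L. \<forall>xs. length xs = fun_ar L s \<longrightarrow> snd N s (map h xs) = h (snd M s xs)) \<longleftrightarrow> ?atoms h"
    (is "?rels \<and> ?funs \<longleftrightarrow> _") if h: "bij h" for h
  proof
    assume i: "?rels \<and> ?funs"
    show "?atoms h"
    proof (intro allI)
      fix k xs
      show "atom L N k (map h xs) = atom L M k xs"
      proof (cases "even k")
        case True
        have "fst N (k div 2) (map h xs) = fst M (k div 2) xs"
        proof (cases "k div 2 \<in> rels L \<and> length xs = rel_ar L (k div 2)")
          case True
          then show ?thesis using i by blast
        next
          case False
          \<comment> \<open>Outside the language or at a wrong length both structures are false, and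
            \<open>map h\<close> does not change lengths.\<close>
          have "s \<in> rels L \<and> length ys = rel_ar L s" if "fst K s ys" "K \<in> Str L" for K s ys
            using that by (cases K) (simp add: Str_def)
          then show ?thesis using False M N by (metis length_map)
        qed
        then show ?thesis using True by (simp add: atom_def)
      next
        case False
        then show ?thesis
          using i bij_is_inj[OF h] by (cases xs) (auto simp: atom_def inj_eq)
      qed
    qed
  next
    assume a: "?atoms h"
    show "?rels \<and> ?funs"
    proof (intro conjI ballI allI impI)
      fix s and xs :: "nat list"
      show "fst N s (map h xs) = fst M s xs"
        using a[rule_format, of "2 * s" xs] by (simp add: atom_def)
    next
      fix s and xs :: "nat list" assume "s \<in> funs L" "length xs = fun_ar L s"
      then show "snd N s (map h xs) = h (snd M s xs)"
        using a[rule_format, of "2 * s + 1" "snd M s xs # xs"] by (simp add: atom_def)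
    qed
  qed
  then show ?thesis unfolding iso_def by blast
qed

section \<open>Continuity of the reduction\<close>

lemma continuous_on_discrete2:
  fixes f :: "'x :: topological_space \<Rightarrow> 'y :: discrete_topology"
    and g :: "'x \<Rightarrow> 'z :: discrete_topology" and H :: "'y \<Rightarrow> 'z \<Rightarrow> 'w :: topological_space"
  assumes f: "continuous_on A f" and g: "continuous_on A g"
  shows "continuous_on A (\<lambda>x. H (f x) (g x))"
proof -
  have "open (U :: ('y \<times> 'z) set)" for U
    unfolding open_prod_def
  proof
    fix p assume "p \<in> U"
    then show "\<exists>A B. open A \<and> open B \<and> p \<in> A \<times> B \<and> A \<times> B \<subseteq> U"
      by (intro exI[of _ "{fst p}"] exI[of _ "{snd p}"]) (auto simp: open_discrete)
  qed
  then have "continuous_on UNIV (\<lambda>p. H (fst p) (snd p))"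
    by (simp add: continuous_on_open_vimage)
  from continuous_on_compose2[OF this continuous_on_Pair[OF f g]] show ?thesis by simp
qed

lemma continuous_on_atom: "continuous_on A (\<lambda>M. atom L M k xs)"
proof (cases "even k")
  case True
  have "continuous_on A (fst :: nat struc \<Rightarrow> _)" by (rule continuous_on_fst[OF continuous_on_id])
  then have "continuous_on A (\<lambda>M :: nat struc. fst M (k div 2))"
    by (rule continuous_on_product_then_coordinatewise)
  then have "continuous_on A (\<lambda>M :: nat struc. fst M (k div 2) xs)"
    by (rule continuous_on_product_then_coordinatewise)
  then show ?thesis using True by (simp add: atom_def)
next
  case False
  have "continuous_on A (snd :: nat struc \<Rightarrow> _)" by (rule continuous_on_snd[OF continuous_on_id])
  then have "continuous_on A (\<lambda>M :: nat struc. snd M (k div 2))"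
    by (rule continuous_on_product_then_coordinatewise)
  then have "continuous_on A (\<lambda>M :: nat struc. snd M (k div 2) (tl xs))"
    by (rule continuous_on_product_then_coordinatewise)
  from continuous_on_discrete2[OF this this, of "\<lambda>y _. xs \<noteq> [] \<and> k div 2 \<in> funs L \<and>
      length (tl xs) = fun_ar L (k div 2) \<and> y = hd xs"]
  show ?thesis using False by (simp add: atom_def)
qed

context tree_coding
begin

lemma continuous_on_struct_encode: "continuous_on A (\<lambda>M. struct (encode L M))"
proof -
  have "continuous_on A (\<lambda>M. fst (struct (encode L M)) p xs)" for p xs
  proof -
    obtain \<Phi> where \<Phi>: "\<forall>S. fst (struct S) p xs = \<Phi> (S (THE ns. listed (fst (en (xs ! 0))) ns))
      (S (THE ns. listed (fst (en (xs ! 1))) ns))" using struct_rel_local[of p xs] by (rule exE)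
    show ?thesis
      unfolding \<Phi>[rule_format] encode_def by (rule continuous_on_discrete2[OF continuous_on_atom continuous_on_atom])
  qed
  then have "continuous_on A (\<lambda>M. fst (struct (encode L M)))"
    by (intro continuous_on_coordinatewise_then_product)
  moreover have "snd (struct S) = (\<lambda>_ _. 0)" for S by (simp add: struct_def)
  ultimately have "continuous_on A (\<lambda>M. (fst (struct (encode L M)), snd (struct (encode L M))))"
    by (intro continuous_on_Pair) (simp_all add: continuous_on_const)
  then show ?thesis by simp
qed

lemma borel_complete_T_P: "borel_complete (lang_P P) (T_P P r \<delta>)"
  unfolding borel_complete_def
proof (intro allI ballI)
  fix L :: "nat lang" and \<Phi> :: "nat fm"
  have "(\<lambda>M. struct (encode L M)) \<in> measurable (restrict_space borel (Mod L {\<Phi>}))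
      (restrict_space borel (Mod (lang_P P) (T_P P r \<delta>)))"
    by (intro measurable_restrict_space2 borel_measurable_continuous_on_restrict
        continuous_on_struct_encode) (simp add: struct_Mod)
  moreover have "iso L M N \<longleftrightarrow> iso (lang_P P) (struct (encode L M)) (struct (encode L N))"
    if "M \<in> Mod L {\<Phi>}" "N \<in> Mod L {\<Phi>}" for M N
    using iso_iff_atom[of M L N] that unfolding iso_struct_iff encode_iff_atom Mod_def by blast
  ultimately show "\<exists>f. borel_reduction L {\<Phi>} (lang_P P) (T_P P r \<delta>) f"
    unfolding borel_reduction_def by blast
qed

end


definition by_side :: "(nat \<Rightarrow> 'x) \<Rightarrow> (nat \<Rightarrow> 'x) \<Rightarrow> bool \<times> nat \<times> nat \<Rightarrow> 'x" where
  "by_side f g j = (if fst j then g (prod_encode (snd j)) else f (prod_encode (snd j)))"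

text \<open>Each side gets its own sequence of blocks, indexed by codes of pairs
  \<open>(i, n)\<close>. Since \<open>len\<close> extracts \<open>n\<close>, every slot has a block
  for each prefix length \<open>Suc n\<close>.\<close>

lemma tree_coding_exists:
  assumes P: "in_PP P r \<delta>" and Q: "downward_closed P r Q" "\<not> bdd r \<delta> Q" "\<not> bdd r \<delta> (P - Q)"
  shows "\<exists>C t \<beta> act. tree_coding P r \<delta> Q C t \<beta> act"
proof -
  define len where "len j = snd (prod_decode j)" for j
  have QP: "Q \<subseteq> P" using Q(1) by (simp add: downward_closed_def)
  obtain C0 t0 \<beta>0 act0 where 0: "\<And>j. C0 j \<subseteq> Q"
    "\<And>j. block P r \<delta> (Suc (len j)) (C0 j) (t0 j) (\<beta>0 j) (act0 j)"
    "\<And>i j. i \<noteq> j \<Longrightarrow> C0 i \<inter> C0 j = {}"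
    using unbounded_blocks[OF P QP Q(2), of len] by blast
  obtain C1 t1 \<beta>1 act1 where 1: "\<And>j. C1 j \<subseteq> P - Q"
    "\<And>j. block P r \<delta> (Suc (len j)) (C1 j) (t1 j) (\<beta>1 j) (act1 j)"
    "\<And>i j. i \<noteq> j \<Longrightarrow> C1 i \<inter> C1 j = {}"
    using unbounded_blocks[OF P Diff_subset Q(3), of len] by blast
  have "tree_coding P r \<delta> Q (by_side C0 C1) (by_side t0 t1) (by_side \<beta>0 \<beta>1) (by_side act0 act1)"
  proof (rule tree_coding.intro)
    show "in_PP P r \<delta>" "downward_closed P r Q" using P Q(1) .
    show "block P r \<delta> (Suc (snd (snd j))) (by_side C0 C1 j) (by_side t0 t1 j) (by_side \<beta>0 \<beta>1 j) (by_side act0 act1 j)" for j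
      using 0(2)[of "prod_encode (snd j)"] 1(2)[of "prod_encode (snd j)"] by (simp add: by_side_def len_def)
    show "by_side C0 C1 i \<inter> by_side C0 C1 j = {}" if "i \<noteq> j" for i j
    proof (cases "fst i = fst j")
      case True
      then have "prod_encode (snd i) \<noteq> prod_encode (snd j)"
        using that by (auto simp: prod_eq_iff inj_eq[OF inj_prod_encode])
      then show ?thesis using True 0(3) 1(3) by (simp add: by_side_def)
    next
      case False
      then show ?thesis
        using 0(1)[of "prod_encode (snd i)"] 0(1)[of "prod_encode (snd j)"]
          1(1)[of "prod_encode (snd i)"] 1(1)[of "prod_encode (snd j)"] by (auto simp: by_side_def)
    qed
    show "by_side C0 C1 j \<subseteq> (if fst j then P - Q else Q)" for j
      using 0(1) 1(1) by (simp add: by_side_def)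
  qed
  then show ?thesis by blast
qed

theorem theorem1p2:
  fixes P :: "'a set" and r :: "'a rel" and \<delta> :: "'a \<Rightarrow> nat"
  assumes "in_PP P r \<delta>"
    and "\<not> bdd r \<delta> P"
    and "\<not> minimally_unbounded P r \<delta>"
  shows "borel_complete (lang_P P) (T_P P r \<delta>)"
proof -
  obtain Q where "downward_closed P r Q" "\<not> bdd r \<delta> Q" "\<not> bdd r \<delta> (P - Q)"
    using assms(2,3) unfolding minimally_unbounded_def by blast
  then obtain C t \<beta> act where "tree_coding P r \<delta> Q C t \<beta> act"
    using tree_coding_exists[OF assms(1)] by blast
  then show ?thesis by (rule tree_coding.borel_complete_T_P)
qed

end
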